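(* Let $G\subset O(p,q)$ be a connected Lie subgroup of $O(p,q)$ which acts irreducibly on $\mathbb{R}^{p+q}$. If $G$ is not semisimple, then $p$ and $q$ are even and $G$ is (up to conjugation in $O(p,q)$) a subgroup of $U(p/2,q/2)$, and the center of $G$ is $U(1)$.
   Context: $O(p,q)$ is the isometry group of the standard inner product of signature $(p,q)$ on $\mathbb{R}^{p+q}$. "Lie subgroup" means an immersed (not necessarily embedded) Lie subgroup. A Lie group is semisimple if its Lie algebra is semisimple (the zero Lie algebra counts as semisimple). For $p,q$ even, $U(p/2,q/2)\subset O(p,q)$ denotes the subgroup of elements commuting with an orthogonal complex structure $J\in O(p,q)$, $J^2=-Id$; such a $J$ identifies $\mathbb{R}^{p+q}$ with $\mathbb{C}^{(p+q)/2}$ with a Hermitian form of signature $(p/2,q/2)$. $U(1)$ denotes the circle group of unit complex scalars $\{(\cos t)\,Id+(\sin t)\,J\mid t\in\mathbb{R}\}$. *)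

theory Defs
  imports "HOL-Analysis.Analysis"
begin

text \<open>
  The model space of a manifold is a linear subspace \<open>E\<close> of a normed space, so that the dimension
  of the manifold (possibly 0) is not tied to a type. In \<open>Ck_on\<close>, the set \<open>V\<close> is meant to be
  relatively open in \<open>E\<close>; the derivative \<open>f' x\<close> is then uniquely determined on \<open>E\<close>, and
  only its values on \<open>E\<close> are used.
\<close>

primrec Ck_on ::
  "nat \<Rightarrow> 'e::real_normed_vector set \<Rightarrow> 'e set \<Rightarrow> ('e \<Rightarrow> 'f::real_normed_vector) \<Rightarrow> bool" where
  "Ck_on 0 E V f \<longleftrightarrow> continuous_on V f"
| "Ck_on (Suc k) E V f \<longleftrightarrow>
     (\<exists>f'. (\<forall>x\<in>V. (f has_derivative f' x) (at x within V)) \<and>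
           (\<forall>v\<in>E. Ck_on k E V (\<lambda>x. f' x v)))"

definition smooth_on ::
  "'e::real_normed_vector set \<Rightarrow> 'e set \<Rightarrow> ('e \<Rightarrow> 'f::real_normed_vector) \<Rightarrow> bool" where
  "smooth_on E V f \<longleftrightarrow> (\<forall>k. Ck_on k E V f)"

record ('a, 'e) manifold =
  mtop :: "'a topology"
  model :: "'e set"
  charts :: "('a set \<times> ('a \<Rightarrow> 'e)) set"

definition second_countable_space :: "'a topology \<Rightarrow> bool" where
  "second_countable_space X \<longleftrightarrow>
     (\<exists>B. countable B \<and> (\<forall>W\<in>B. openin X W) \<and>
          (\<forall>U x. openin X U \<and> x \<in> U \<longrightarrow> (\<exists>W\<in>B. x \<in> W \<and> W \<subseteq> U)))"

definition smooth_manifold :: "('a, 'e::real_normed_vector) manifold \<Rightarrow> bool" where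
  "smooth_manifold M \<longleftrightarrow>
     subspace (model M) \<and>
     Hausdorff_space (mtop M) \<and> second_countable_space (mtop M) \<and>
     (\<forall>(U, \<phi>) \<in> charts M.
        openin (mtop M) U \<and> openin (top_of_set (model M)) (\<phi> ` U) \<and>
        homeomorphic_map (subtopology (mtop M) U) (top_of_set (\<phi> ` U)) \<phi>) \<and>
     \<Union> (fst ` charts M) = topspace (mtop M) \<and>
     (\<forall>(U, \<phi>) \<in> charts M. \<forall>(V, \<psi>) \<in> charts M.
        smooth_on (model M) (\<phi> ` (U \<inter> V)) (\<lambda>z. \<psi> (inv_into U \<phi> z)))"

definition prod_manifold ::
  "('a, 'e) manifold \<Rightarrow> ('b, 'f) manifold \<Rightarrow> ('a \<times> 'b, 'e \<times> 'f) manifold" where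
  "prod_manifold M N =
     \<lparr> mtop = prod_topology (mtop M) (mtop N),
       model = model M \<times> model N,
       charts = {(U \<times> V, map_prod \<phi> \<psi>) | U \<phi> V \<psi>. (U, \<phi>) \<in> charts M \<and> (V, \<psi>) \<in> charts N} \<rparr>"

definition euclidean_manifold :: "('e::real_normed_vector, 'e) manifold" where
  "euclidean_manifold = \<lparr> mtop = euclidean, model = UNIV, charts = {(UNIV, \<lambda>x. x)} \<rparr>"

definition smooth_map ::
  "('a, 'e::real_normed_vector) manifold \<Rightarrow> ('b, 'f::real_normed_vector) manifold
     \<Rightarrow> ('a \<Rightarrow> 'b) \<Rightarrow> bool" where
  "smooth_map M N f \<longleftrightarrow>
     continuous_map (mtop M) (mtop N) f \<and>
     (\<forall>(U, \<phi>) \<in> charts M. \<forall>(V, \<psi>) \<in> charts N.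
        smooth_on (model M) (\<phi> ` {x \<in> U. f x \<in> V}) (\<lambda>z. \<psi> (f (inv_into U \<phi> z))))"

definition immersion ::
  "('a, 'e::real_normed_vector) manifold \<Rightarrow> ('a \<Rightarrow> 'f::real_normed_vector) \<Rightarrow> bool" where
  "immersion M f \<longleftrightarrow>
     smooth_map M euclidean_manifold f \<and>
     (\<forall>(U, \<phi>) \<in> charts M. \<forall>x\<in>U. \<exists>D.
        ((\<lambda>z. f (inv_into U \<phi> z)) has_derivative D) (at (\<phi> x) within \<phi> ` U) \<and>
        inj_on D (model M))"

definition matrix_subgroup :: "(real^'n^'n) set \<Rightarrow> (real^'n^'n) set \<Rightarrow> bool" where
  "matrix_subgroup G H \<longleftrightarrow>
     G \<subseteq> H \<and> mat 1 \<in> G \<and> (\<forall>a\<in>G. \<forall>b\<in>G. a ** b \<in> G) \<and>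
     (\<forall>a\<in>G. invertible a \<and> matrix_inv a \<in> G)"

text \<open>
  The manifold topology of \<open>M\<close> may be strictly finer than the one induced from the matrices.
  An immersed submanifold of the matrix space has dimension at most \<open>n\<^sup>2\<close>, hence a linear subspace
  of the matrix space can always serve as its model space. The ambient group \<open>H\<close> is used here
  only when it is an embedded submanifold of the matrix space, so an immersion into \<open>H\<close> is the same
  as an immersion into the matrix space.
\<close>

definition lie_subgroup ::
  "(real^'n^'n, real^'n^'n) manifold \<Rightarrow> (real^'n^'n) set \<Rightarrow> (real^'n^'n) set \<Rightarrow> bool" where
  "lie_subgroup M G H \<longleftrightarrow>
     matrix_subgroup G H \<and>
     smooth_manifold M \<and> topspace (mtop M) = G \<and>
     smooth_map (prod_manifold M M) M (\<lambda>(a, b). a ** b) \<and>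
     smooth_map M M matrix_inv \<and>
     immersion M (\<lambda>a. a)"

text \<open>
  The Lie algebra is the tangent space at the identity, carried into the matrix space by the
  (injective) differential of the inclusion; its Lie bracket is then the matrix commutator.
\<close>

definition lie_algebra_of :: "(real^'n^'n, real^'n^'n) manifold \<Rightarrow> (real^'n^'n) set" where
  "lie_algebra_of M =
     {X. \<exists>(U, \<phi>) \<in> charts M. mat 1 \<in> U \<and>
        (\<exists>D. (inv_into U \<phi> has_derivative D) (at (\<phi> (mat 1)) within \<phi> ` U) \<and>
             X \<in> D ` model M)}"

definition lie_bracket :: "real^'n^'n \<Rightarrow> real^'n^'n \<Rightarrow> real^'n^'n" where
  "lie_bracket X Y = X ** Y - Y ** X"

definition lie_ideal :: "(real^'n^'n) set \<Rightarrow> (real^'n^'n) set \<Rightarrow> bool" where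
  "lie_ideal I L \<longleftrightarrow> subspace I \<and> I \<subseteq> L \<and> (\<forall>X\<in>L. \<forall>Y\<in>I. lie_bracket X Y \<in> I)"

definition derived_algebra :: "(real^'n^'n) set \<Rightarrow> (real^'n^'n) set" where
  "derived_algebra L = span {lie_bracket X Y | X Y. X \<in> L \<and> Y \<in> L}"

definition solvable_lie_algebra :: "(real^'n^'n) set \<Rightarrow> bool" where
  "solvable_lie_algebra L \<longleftrightarrow> (\<exists>k. (derived_algebra ^^ k) L = {0})"

text \<open>Vanishing radical: no solvable ideal other than 0. The zero algebra qualifies.\<close>

definition semisimple_lie_algebra :: "(real^'n^'n) set \<Rightarrow> bool" where
  "semisimple_lie_algebra L \<longleftrightarrow>
     (\<forall>I. lie_ideal I L \<and> solvable_lie_algebra I \<longrightarrow> I = {0})"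

definition center :: "(real^'n^'n) set \<Rightarrow> (real^'n^'n) set" where
  "center G = {z \<in> G. \<forall>g\<in>G. z ** g = g ** z}"

definition acts_irreducibly :: "(real^'n^'n) set \<Rightarrow> bool" where
  "acts_irreducibly G \<longleftrightarrow>
     (\<forall>W. subspace W \<and> (\<forall>g\<in>G. \<forall>w\<in>W. g *v w \<in> W) \<longrightarrow> W = {0} \<or> W = UNIV)"

text \<open>
  \<open>P\<close> is the set of coordinates that carry a positive sign, so the signature of the form is
  \<open>(card P, card (- P))\<close>; either number may be 0.
\<close>

definition std_form :: "'n set \<Rightarrow> real^'n \<Rightarrow> real^'n \<Rightarrow> real" where
  "std_form P x y = (\<Sum>i\<in>P. x $ i * y $ i) - (\<Sum>i\<in>- P. x $ i * y $ i)"

definition O_group :: "'n set \<Rightarrow> (real^'n^'n) set" where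
  "O_group P = {A. \<forall>x y. std_form P (A *v x) (A *v y) = std_form P x y}"

definition orthogonal_complex_structure :: "'n set \<Rightarrow> real^'n^'n \<Rightarrow> bool" where
  "orthogonal_complex_structure P J \<longleftrightarrow> J \<in> O_group P \<and> J ** J = - mat 1"

definition U_group :: "'n set \<Rightarrow> real^'n^'n \<Rightarrow> (real^'n^'n) set" where
  "U_group P J = {A \<in> O_group P. A ** J = J ** A}"

definition U1_group :: "real^'n^'n \<Rightarrow> (real^'n^'n) set" where
  "U1_group J = {cos t *\<^sub>R mat 1 + sin t *\<^sub>R J | t. True}"

definition conjugate :: "real^'n^'n \<Rightarrow> (real^'n^'n) set \<Rightarrow> (real^'n^'n) set" where
  "conjugate h G = (\<lambda>g. h ** g ** matrix_inv h) ` G"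

end

theory Submission
  imports Defs "HOL-Computational_Algebra.Fundamental_Theorem_Algebra"
begin

text \<open>
  Let \<open>L\<close> be the Lie algebra of \<open>G\<close>. A smooth curve \<open>\<gamma>\<close> in \<open>G\<close> satisfies a linear equation \<open>\<gamma>' = X \<gamma>\<close> with
  coefficients \<open>X\<close> in \<open>L\<close>, so on a connected group linear conditions that \<open>L\<close> propagates hold
  everywhere as soon as they hold at the identity (\<open>vanishing_on_connected_group\<close>). Thus subspaces
  invariant under \<open>L\<close> are invariant under \<open>G\<close>, and \<open>L\<close> acts irreducibly as well; and what commutes
  with \<open>L\<close> commutes with \<open>G\<close>.

  If \<open>L\<close> is not semisimple, the last nonzero term of the derived series of a solvable ideal is a
  nonzero abelian ideal \<open>A\<close>. For \<open>X\<close> in \<open>L\<close> and \<open>a\<close> in \<open>A\<close> the bracket \<open>[X, a]\<close> commutes with \<open>a\<close>,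
  which forces it to be nilpotent. All these brackets commute with each other, so they have a
  nonzero common kernel; it is invariant under \<open>L\<close>, hence it is the whole space and all brackets
  vanish. So \<open>A\<close> is central in \<open>L\<close> (\<open>abelian_ideal_central\<close>) and commutes with \<open>G\<close>.

  Take \<open>Z \<noteq> 0\<close> in \<open>A\<close>. By Schur's lemma and the fundamental theorem of algebra, a matrix commuting
  with \<open>G\<close> satisfies a real quadratic equation \<open>(z - \<alpha>)\<^sup>2 = - \<beta>\<^sup>2\<close>. Since \<open>Z\<close> is skew for the form,
  \<open>\<alpha> = 0\<close>, and \<open>J = Z / \<beta>\<close> is an orthogonal complex structure commuting with \<open>G\<close>.

  The circle \<open>cos t + sin t J\<close> consists of the exponentials of multiples of \<open>Z\<close>. These lie in \<open>G\<close>
  although \<open>G\<close> need not be closed among the matrices, because the approximating products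
  \<open>\<gamma>(t/n)\<^sup>n\<close> stay in a compact part of one chart (\<open>one_parameter_small\<close>). They commute with \<open>G\<close>, so the
  circle is contained in the center. Conversely, a central element \<open>z\<close> commutes with \<open>J\<close>, so its
  quadratic equation factors over \<open>\<real>[J]\<close> and \<open>z = \<alpha> \<plusminus> \<beta> J\<close>; as \<open>z\<close> preserves the form,
  \<open>\<alpha>\<^sup>2 + \<beta>\<^sup>2 = 1\<close>.

  Finally, for every orthogonal complex structure \<open>J\<close> there is a basis of pairs \<open>e\<close>, \<open>J e\<close> which is
  orthonormal up to signs. By Sylvester's law of inertia it contains \<open>p/2\<close> positive and \<open>q/2\<close>
  negative pairs. This proves that \<open>p\<close> and \<open>q\<close> are even, and matching the bases of two such
  structures conjugates one into the other inside \<open>O(p,q)\<close> (\<open>complex_structures_conjugate\<close>).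
\<close>

section \<open>Polynomials in an element of a real algebra\<close>

text \<open>
  Horner's scheme for the substitution homomorphism from \<open>\<real>[x]\<close> that sends \<open>x\<close> to \<open>a\<close>.
\<close>

definition peval :: "real poly \<Rightarrow> 'a::real_algebra_1 \<Rightarrow> 'a" where
  "peval p a = fold_coeffs (\<lambda>c x. c *\<^sub>R 1 + a * x) p 0"

lemma peval_0 [simp]: "peval 0 a = 0"
  by (simp add: peval_def)

lemma peval_pCons [simp]: "peval (pCons c p) a = c *\<^sub>R 1 + a * peval p a"
  by (cases "p = 0 \<and> c = 0") (auto simp: peval_def)

lemma peval_add [simp]: "peval (p + q) a = peval p a + peval q a"
  by (induction p q rule: poly_induct2) (auto simp: algebra_simps)

lemma peval_smult [simp]: "peval (smult c p) a = c *\<^sub>R peval p a"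
  by (induction p) (auto simp: algebra_simps)

lemma peval_mult: "peval (p * q) a = peval p a * peval q a"
  by (induction p) (auto simp: algebra_simps)

lemma peval_diff [simp]: "peval (p - q) a = peval p a - peval q a"
  using peval_add[of "p - q" q a] by (simp add: algebra_simps)

lemma peval_sum: "peval (sum f A) a = (\<Sum>i\<in>A. peval (f i) a)"
  by (induction A rule: infinite_finite_induct) auto

lemma peval_monom: "peval (monom c n) a = c *\<^sub>R a ^ n"
  by (induction n) (auto simp: monom_0 monom_Suc)

lemma peval_commute:
  assumes "a * b = b * a"
  shows "peval p a * b = b * peval p a"
proof (induction p)
  case (pCons c p)
  have "a * (peval p a * b) = b * (a * peval p a)"
    using pCons assms by (metis mult.assoc)
  then show ?case
    by (simp add: algebra_simps)
qed auto

text \<open>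
  Commutation with \<open>x\<close> is a derivation, and \<open>b = [x, a]\<close> commutes with \<open>a\<close>; so on polynomials in \<open>a\<close>
  it acts as \<open>b\<close> times formal differentiation.
\<close>

lemma commutator_peval:
  assumes "a * b = b * a" and b: "b = x * a - a * x"
  shows "x * peval p a - peval p a * x = peval (pderiv p) a * b"
proof (induction p)
  case (pCons c p)
  have "x * peval (pCons c p) a - peval (pCons c p) a * x
        = b * peval p a + a * (x * peval p a - peval p a * x)"
    by (simp add: b algebra_simps)
  also have "\<dots> = peval p a * b + a * (peval (pderiv p) a * b)"
    using pCons peval_commute[OF assms(1)] by simp
  finally show ?case
    by (simp add: pderiv_pCons algebra_simps)
qed auto

lemma commutator_power:
  fixes b :: "'a::real_algebra_1"
  assumes "b * c = c * b" and c: "c = x * b - b * x"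
  shows "x * b ^ m - b ^ m * x = real m *\<^sub>R b ^ (m - 1) * c"
  using commutator_peval[OF assms, of "monom 1 m"]
  by (simp add: peval_monom pderiv_monom)

text \<open>
  Commuting \<open>x\<close> with \<open>p(a) b\<^sup>m = 0\<close> gives \<open>p'(a) b\<^sup>m\<^sup>+\<^sup>1 + m p(a) b\<^sup>m\<^sup>-\<^sup>1 c = 0\<close>. One more factor \<open>b\<close> kills
  the second summand and leaves \<open>p'(a) b\<^sup>m\<^sup>+\<^sup>2 = 0\<close>. After \<open>degree p\<close> such steps the polynomial is a
  nonzero constant. In the application \<open>p\<close> annihilates \<open>a\<close> and \<open>m = 0\<close>.
\<close>

lemma nilpotent_of_annihilated:
  fixes a :: "'a::real_algebra_1"
  assumes ab: "a * b = b * a" and b: "b = x * a - a * x"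
    and bc: "b * c = c * b" and ac: "a * c = c * a" and c: "c = x * b - b * x"
    and "p \<noteq> 0" and "peval p a * b ^ m = 0"
  shows "\<exists>N. b ^ N = 0"
  using assms(6,7)
proof (induction "degree p" arbitrary: p m)
  case 0
  then obtain k where "p = [:k:]" "k \<noteq> 0"
    by (metis degree_eq_zeroE pCons_0_0)
  with 0 have "k *\<^sub>R b ^ m = 0"
    by simp
  with \<open>k \<noteq> 0\<close> show ?case by auto
next
  case (Suc n)
  let ?P = "peval p a" and ?P' = "peval (pderiv p) a"
  have "pderiv p \<noteq> 0" "n = degree (pderiv p)"
    using Suc.hyps(2) by (auto simp: pderiv_eq_0_iff degree_pderiv)
  have "0 = x * (?P * b ^ m) - (?P * b ^ m) * x"
    using Suc.prems by simp
  also have "\<dots> = (x * ?P - ?P * x) * b ^ m + ?P * (x * b ^ m - b ^ m * x)"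
    by (simp add: algebra_simps)
  also have "\<dots> = ?P' * b ^ Suc m + real m *\<^sub>R (?P * b ^ (m - 1) * c)"
    by (simp add: commutator_peval[OF ab b] commutator_power[OF bc c] mult.assoc)
  finally have *: "0 = (?P' * b ^ Suc m + real m *\<^sub>R (?P * b ^ (m - 1) * c)) * b"
    by simp
  \<comment> \<open>The factor \<open>b\<close> completes \<open>b\<^sup>m\<^sup>-\<^sup>1\<close> to \<open>b\<^sup>m\<close>; for \<open>m = 0\<close> the coefficient is 0.\<close>
  have "real m *\<^sub>R (?P * b ^ (m - 1) * c * b) = 0"
  proof (cases m)
    case (Suc k)
    have "?P * b ^ k * c * b = ?P * b ^ m * c"
      using bc Suc by (simp add: mult.assoc power_commutes) (metis mult.assoc power_commutes)
    with Suc Suc.prems show ?thesis by simp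
  qed simp
  with * have "?P' * b ^ Suc (Suc m) = 0"
    by (simp only: distrib_right mult.assoc scaleR_scaleR mult_scaleR_left power_Suc2) simp
  then show ?case
    using Suc.hyps(1)[OF \<open>n = _\<close> \<open>pderiv p \<noteq> 0\<close>] by blast
qed

lemma poly_map_poly_of_real: "poly (map_poly complex_of_real p) z = peval p z"
  by (induction p) (auto simp: map_poly_pCons scaleR_conv_of_real)

text \<open>
  If \<open>z\<close> is not real, the remainder of \<open>p\<close> modulo the real minimal polynomial of \<open>z\<close> is a real
  polynomial of degree at most 1 with the root \<open>z\<close>, hence 0.
\<close>

lemma real_poly_root_factor:
  assumes "peval p (z::complex) = 0"
  shows "Im z = 0 \<Longrightarrow> [:- Re z, 1:] dvd p"
    and "Im z \<noteq> 0 \<Longrightarrow> [:(Re z)\<^sup>2 + (Im z)\<^sup>2, - 2 * Re z, 1:] dvd p"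
proof -
  assume "Im z = 0"
  then have z: "z = of_real (Re z)" by (simp add: complex_eq_iff)
  have "peval p (complex_of_real x) = of_real (poly p x)" for x
    by (induction p) (auto simp: scaleR_conv_of_real)
  with assms z have "poly p (Re z) = 0"
    by (metis of_real_eq_0_iff)
  then show "[:- Re z, 1:] dvd p"
    by (simp add: poly_eq_0_iff_dvd)
next
  assume "Im z \<noteq> 0"
  define q where "q = [:(Re z)\<^sup>2 + (Im z)\<^sup>2, - 2 * Re z, 1:]"
  have q: "q \<noteq> 0" "degree q = 2" by (auto simp: q_def)
  define r where "r = p mod q"
  have "degree r < 2"
    using degree_mod_less[OF q(1), of p] q(2) by (auto simp: r_def)
  define u v where "u = coeff r 0" and "v = coeff r 1"
  have r: "r = [:u, v:]"
    using \<open>degree r < 2\<close> unfolding u_def v_def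
    by (intro poly_eqI) (auto simp: coeff_pCons coeff_eq_0 split: nat.splits)
  have "peval q z = 0"
    by (auto simp: q_def complex_eq_iff power2_eq_square algebra_simps)
  moreover have "p = q * (p div q) + r"
    by (simp add: r_def)
  ultimately have "peval r z = 0"
    using assms peval_add[of "q * (p div q)" r z] peval_mult[of q "p div q" z] by simp
  then have "u + Re z * v = 0" "Im z * v = 0"
    unfolding r by (auto simp: complex_eq_iff mult.commute)
  with \<open>Im z \<noteq> 0\<close> have "r = 0" by (simp add: r)
  then show "q dvd p" by (simp add: r_def mod_eq_0_iff_dvd)
qed

text \<open>
  A complex root of \<open>p\<close> provides a real factor \<open>q\<close> of degree 1 or 2. Either the cofactor already
  annihilates \<open>a\<close>, and it has smaller degree, or its value at \<open>a\<close> is the required \<open>c\<close>. A factor of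
  degree 1 is covered by \<open>\<beta> = 0\<close>, as its square kills \<open>c\<close> too.
\<close>

lemma exists_quadratic_zero_divisor:
  fixes a :: "'a::real_algebra_1"
  assumes "p \<noteq> 0" and "peval p a = 0"
  shows "\<exists>\<alpha> \<beta> c. c \<noteq> 0 \<and> ((a - \<alpha> *\<^sub>R 1) * (a - \<alpha> *\<^sub>R 1) + \<beta>\<^sup>2 *\<^sub>R 1) * c = 0"
  using assms
proof (induction "degree p" arbitrary: p rule: less_induct)
  case less
  show ?case
  proof (cases "degree p = 0")
    case True
    then obtain k where "p = [:k:]" by (metis degree_eq_zeroE)
    with less.prems show ?thesis by simp
  next
    case False
    then have "\<not> constant (poly (map_poly complex_of_real p))"
      by (simp add: constant_degree degree_map_poly)
    then obtain z :: complex where z: "peval p z = 0"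
      using fundamental_theorem_of_algebra[of "map_poly complex_of_real p"]
      by (auto simp: poly_map_poly_of_real)
    define q where "q = (if Im z = 0 then [:- Re z, 1:] else [:(Re z)\<^sup>2 + (Im z)\<^sup>2, - 2 * Re z, 1:])"
    have q: "degree q > 0" "q dvd p"
      using real_poly_root_factor[OF z] by (auto simp: q_def)
    then obtain g where g: "p = q * g" by blast
    with less.prems q have "g \<noteq> 0" "degree g < degree p"
      by (auto simp: degree_mult_eq)
    show ?thesis
    proof (cases "peval g a = 0")
      case True
      with less.hyps \<open>g \<noteq> 0\<close> \<open>degree g < degree p\<close> show ?thesis by blast
    next
      case False
      have 0: "peval q a * peval g a = 0"
        using less.prems g by (simp add: peval_mult)
      have "((a - Re z *\<^sub>R 1) * (a - Re z *\<^sub>R 1) + (Im z)\<^sup>2 *\<^sub>R 1) * peval g a = 0"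
      proof (cases "Im z = 0")
        case True
        with 0 have "(a - Re z *\<^sub>R 1) * peval g a = 0"
          by (simp add: q_def algebra_simps)
        with True show ?thesis by (simp add: mult.assoc)
      next
        case False
        have "(a - Re z *\<^sub>R 1) * (a - Re z *\<^sub>R 1) + (Im z)\<^sup>2 *\<^sub>R 1 = peval q a"
          using False by (simp add: q_def algebra_simps power2_eq_square) (metis mult_2_right scaleR_add_left)
        with 0 show ?thesis by simp
      qed
      with False show ?thesis by blast
    qed
  qed
qed

text \<open>
  The map \<open>r\<close> only serves to bound the dimension of the algebra: one power of \<open>a\<close> more than the
  dimension must be linearly dependent. Two equal powers are treated apart, because they collapse
  in the set of powers.
\<close>

lemma exists_annihilating_poly:
  fixes a :: "'a::real_algebra_1" and r :: "'a \<Rightarrow> 'b::euclidean_space"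
  assumes "linear r" "inj r"
  shows "\<exists>p \<noteq> 0. peval p a = 0"
proof (cases "inj_on (\<lambda>i. a ^ i) {..DIM('b)}")
  case False
  then obtain i j where ij: "i \<noteq> j" "a ^ i = a ^ j" by (auto simp: inj_on_def)
  then have "monom 1 i - monom (1::real) j \<noteq> 0"
    by (metis eq_iff_diff_eq_0 monom_eq_iff' zero_neq_one)
  then show ?thesis
    using ij by (intro exI[of _ "monom 1 i - monom 1 j"]) (simp add: peval_monom)
next
  case True
  let ?f = "\<lambda>i. r (a ^ i)"
  have inj: "inj_on ?f {..DIM('b)}"
    using True \<open>inj r\<close> by (auto simp: inj_on_def)
  then have "card (?f ` {..DIM('b)}) > DIM('b)" by (simp add: card_image)
  then have "dependent (?f ` {..DIM('b)})"
    using dependent_biggerset by blast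
  then obtain u where u: "\<exists>v\<in>?f ` {..DIM('b)}. u v \<noteq> 0" "(\<Sum>v\<in>?f ` {..DIM('b)}. u v *\<^sub>R v) = 0"
    by (auto simp: dependent_finite)
  define p where "p = (\<Sum>i\<le>DIM('b). monom (u (?f i)) i)"
  have "r (peval p a) = 0"
    using u(2) inj by (simp add: p_def peval_sum peval_monom linear_sum[OF assms(1)]
        linear_scale[OF assms(1)] sum.reindex)
  then have "peval p a = 0"
    using assms by (metis injD linear_0)
  moreover obtain i where i: "i \<le> DIM('b)" "u (?f i) \<noteq> 0" using u(1) by auto
  have "coeff p i = u (?f i)"
    using i by (simp add: p_def coeff_sum if_distrib cong: if_cong)
  with i have "p \<noteq> 0" by auto
  ultimately show ?thesis by blast
qed

section \<open>Square matrices as an algebra\<close>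

interpretation matmul: bounded_bilinear "(**) :: real^'n::finite^'n \<Rightarrow> real^'n^'n \<Rightarrow> real^'n^'n"
proof -
  have "bilinear ((**) :: real^'n^'n \<Rightarrow> real^'n^'n \<Rightarrow> real^'n^'n)"
    by (auto simp: bilinear_def matrix_add_ldistrib matrix_scalar_ac scalar_matrix_assoc[symmetric]
        matrix_matrix_mult_def vec_eq_iff sum.distrib sum_distrib_left algebra_simps intro!: linearI)
  then show "bounded_bilinear ((**) :: real^'n^'n \<Rightarrow> real^'n^'n \<Rightarrow> real^'n^'n)"
    by (simp add: bilinear_conv_bounded_bilinear)
qed

lemmas matmul_distribs = matmul.add_left matmul.add_right matmul.diff_left matmul.diff_right
  matmul.minus_left matmul.minus_right matmul.scaleR_left matmul.scaleR_right

text \<open>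
  On \<open>real^'n^'n\<close> itself \<open>*\<close> is the entrywise product. The copy has the matrix product as its
  multiplication, which makes it a real algebra to which the preceding section applies.
\<close>

typedef (overloaded) 'n sqmat = "UNIV :: (real^'n::finite^'n) set"
  morphisms mat_of Sqmat by simp

setup_lifting type_definition_sqmat

instantiation sqmat :: (finite) real_algebra_1
begin
lift_definition zero_sqmat :: "'a sqmat" is "0" .
lift_definition one_sqmat :: "'a sqmat" is "mat 1" .
lift_definition plus_sqmat :: "'a sqmat \<Rightarrow> 'a sqmat \<Rightarrow> 'a sqmat" is "(+)" .
lift_definition minus_sqmat :: "'a sqmat \<Rightarrow> 'a sqmat \<Rightarrow> 'a sqmat" is "(-)" .
lift_definition uminus_sqmat :: "'a sqmat \<Rightarrow> 'a sqmat" is "uminus" .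
lift_definition times_sqmat :: "'a sqmat \<Rightarrow> 'a sqmat \<Rightarrow> 'a sqmat" is "(**)" .
lift_definition scaleR_sqmat :: "real \<Rightarrow> 'a sqmat \<Rightarrow> 'a sqmat" is "(*\<^sub>R)" .
instance
proof
  fix a b c :: "'a sqmat" and r s :: real
  show "a + b + c = a + (b + c)" "a + b = b + a" "0 + a = a" "- a + a = 0" "a - b = a + - b"
    "r *\<^sub>R (a + b) = r *\<^sub>R a + r *\<^sub>R b" "(r + s) *\<^sub>R a = r *\<^sub>R a + s *\<^sub>R a"
    "r *\<^sub>R s *\<^sub>R a = (r * s) *\<^sub>R a" "1 *\<^sub>R a = a"
    by (transfer; simp add: algebra_simps)+
  show "a * b * c = a * (b * c)" "1 * a = a" "a * 1 = a"
    by (transfer; simp add: matrix_mul_assoc)+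
  show "(a + b) * c = a * c + b * c" "a * (b + c) = a * b + a * c"
    by (transfer; simp add: matmul_distribs)+
  show "r *\<^sub>R a * b = r *\<^sub>R (a * b)" "a * r *\<^sub>R b = r *\<^sub>R (a * b)"
    by (transfer; simp add: matmul_distribs)+
  show "(0::'a sqmat) \<noteq> 1"
    by transfer (simp add: mat_def vec_eq_iff)
qed
end

lemma mat_of_power: "mat_of (b ^ N) *v v = ((*v) (mat_of b) ^^ N) v"
  by (induction N arbitrary: v)
    (simp_all add: one_sqmat.rep_eq times_sqmat.rep_eq matrix_vector_mul_assoc[symmetric])

lemma annihilating_poly_sqmat: "\<exists>p \<noteq> 0. peval p (a :: 'n::finite sqmat) = 0"
proof (rule exists_annihilating_poly)
  show "linear (mat_of :: 'n sqmat \<Rightarrow> _)"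
    by (rule linearI) (simp_all add: plus_sqmat.rep_eq scaleR_sqmat.rep_eq)
  show "inj (mat_of :: 'n sqmat \<Rightarrow> _)"
    by (simp add: inj_def mat_of_inject)
qed

lemma commutator_nilpotent:
  fixes a X :: "real^'n::finite^'n"
  assumes b: "b = lie_bracket X a" and c: "c = lie_bracket X b"
    and "a ** b = b ** a" "b ** c = c ** b" "a ** c = c ** a"
  shows "\<exists>N. \<forall>v. ((*v) b ^^ N) v = 0"
proof -
  obtain p where p: "p \<noteq> 0" "peval p (Sqmat a) = 0"
    using annihilating_poly_sqmat by blast
  note transfer_simps = times_sqmat.abs_eq minus_sqmat.abs_eq eq_onp_same_args lie_bracket_def
  have "\<exists>N. Sqmat b ^ N = 0"
  proof (rule nilpotent_of_annihilated[where a = "Sqmat a" and x = "Sqmat X" and c = "Sqmat c" and p = p and m = 0])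
    show "Sqmat b = Sqmat X * Sqmat a - Sqmat a * Sqmat X"
      by (simp add: b transfer_simps)
    show "Sqmat c = Sqmat X * Sqmat b - Sqmat b * Sqmat X"
      by (simp add: c transfer_simps)
  qed (simp_all add: transfer_simps assms(3-) p)
  then obtain N where "Sqmat b ^ N = 0" by blast
  then have "((*v) b ^^ N) v = 0" for v
    using mat_of_power[of "Sqmat b" N v] by (simp add: Sqmat_inverse zero_sqmat.rep_eq)
  then show ?thesis by blast
qed

lemma exists_singular_quadratic:
  fixes a :: "real^'n::finite^'n"
  shows "\<exists>\<alpha> \<beta> v. v \<noteq> 0 \<and>
    ((a - \<alpha> *\<^sub>R mat 1) ** (a - \<alpha> *\<^sub>R mat 1) + \<beta>\<^sup>2 *\<^sub>R mat 1) *v v = 0"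
proof -
  obtain \<alpha> \<beta> and c :: "'n sqmat" where "c \<noteq> 0" and
    *: "((Sqmat a - \<alpha> *\<^sub>R 1) * (Sqmat a - \<alpha> *\<^sub>R 1) + \<beta>\<^sup>2 *\<^sub>R 1) * c = 0"
    using exists_quadratic_zero_divisor annihilating_poly_sqmat by metis
  let ?q = "(a - \<alpha> *\<^sub>R mat 1) ** (a - \<alpha> *\<^sub>R mat 1) + \<beta>\<^sup>2 *\<^sub>R mat 1"
  have "?q ** mat_of c = 0"
    using arg_cong[OF *, of mat_of]
    by (simp add: times_sqmat.rep_eq plus_sqmat.rep_eq minus_sqmat.rep_eq scaleR_sqmat.rep_eq
        one_sqmat.rep_eq zero_sqmat.rep_eq Sqmat_inverse)
  moreover have "mat_of c \<noteq> 0"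
    using \<open>c \<noteq> 0\<close> by (metis mat_of_inject zero_sqmat.rep_eq)
  then obtain w where "mat_of c *v w \<noteq> 0"
    by (metis matrix_eq matrix_vector_mult_0)
  ultimately show ?thesis
    by (metis matrix_vector_mul_assoc matrix_vector_mult_0)
qed

section \<open>Abelian ideals of irreducible matrix Lie algebras\<close>

text \<open>
  Let \<open>U\<close> be a nonzero \<open>S\<close>-invariant subspace of least dimension. For \<open>b\<close> in \<open>S\<close> the kernel of \<open>b\<close> in
  \<open>U\<close> is nonzero since \<open>b\<close> is nilpotent, and \<open>S\<close>-invariant since \<open>S\<close> commutes, so by minimality it
  is \<open>U\<close>.
\<close>

lemma common_kernel_of_commuting_nilpotents:
  fixes S :: "(real^'n::finite^'n) set"
  assumes comm: "\<And>a b. a \<in> S \<Longrightarrow> b \<in> S \<Longrightarrow> a ** b = b ** a"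
    and nil: "\<And>b. b \<in> S \<Longrightarrow> \<exists>N. \<forall>v. ((*v) b ^^ N) v = 0"
  shows "\<exists>v \<noteq> 0. \<forall>b \<in> S. b *v v = 0"
proof -
  define inv where "inv U \<longleftrightarrow> subspace U \<and> U \<noteq> {0} \<and> (\<forall>b\<in>S. \<forall>u\<in>U. b *v u \<in> U)"
    for U :: "(real^'n) set"
  have "inv UNIV"
    unfolding inv_def by (metis UNIV_I one_neq_zero singletonD subspace_UNIV vec_eq_iff zero_index one_index)
  then obtain U where U: "inv U" and min: "\<And>V. inv V \<Longrightarrow> dim U \<le> dim V"
    by (metis ex_has_least_nat)
  have "b *v u = 0" if "b \<in> S" "u \<in> U" for b u
  proof -
    let ?V = "{u \<in> U. b *v u = 0}"
    obtain N where N: "\<And>v. ((*v) b ^^ N) v = 0"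
      using nil \<open>b \<in> S\<close> by blast
    obtain w where w: "w \<in> U" "w \<noteq> 0"
      using U by (metis inv_def subspace_0 subsetI subset_singletonD insertCI singletonI empty_iff)
    have inU: "((*v) b ^^ k) w \<in> U" for k
      using U \<open>b \<in> S\<close> w by (induction k) (auto simp: inv_def)
    define k where "k = (LEAST k. ((*v) b ^^ k) w = 0)"
    have k: "((*v) b ^^ k) w = 0"
      unfolding k_def by (rule LeastI) (rule N)
    with w obtain j where j: "k = Suc j" by (cases k) auto
    have "((*v) b ^^ j) w \<noteq> 0"
      using not_less_Least[of j "\<lambda>k. ((*v) b ^^ k) w = 0"] j unfolding k_def by auto
    moreover have "((*v) b ^^ j) w \<in> ?V"
      using k j inU by auto
    ultimately have "?V \<noteq> {0}" by blast
    moreover have "subspace ?V"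
      using U by (auto simp: inv_def subspace_def matrix_vector_right_distrib matrix_vector_mult_scaleR)
    moreover have "a *v v \<in> ?V" if "a \<in> S" "v \<in> ?V" for a v
    proof -
      have "b *v (a *v v) = a *v (b *v v)"
        using comm[OF \<open>a \<in> S\<close> \<open>b \<in> S\<close>] by (simp add: matrix_vector_mul_assoc)
      with that U show ?thesis by (auto simp: inv_def)
    qed
    ultimately have "inv ?V" by (auto simp: inv_def)
    then have "?V = U"
      using min[of ?V] U by (intro subspace_dim_equal) (auto simp: inv_def)
    with \<open>u \<in> U\<close> show ?thesis by blast
  qed
  moreover obtain u where "u \<in> U" "u \<noteq> 0"
    using U by (metis inv_def subspace_0 subsetI subset_singletonD insertCI singletonI empty_iff)
  ultimately show ?thesis by blast
qed

text \<open>
  The brackets of \<open>L\<close> with \<open>A\<close> lie in \<open>A\<close>, so they commute, and each is nilpotent. Bracketing such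
  a bracket with \<open>X\<close> in \<open>L\<close> gives another one; therefore their common kernel is \<open>L\<close>-invariant, and
  irreducibility makes it the whole space.
\<close>

lemma abelian_ideal_central:
  fixes L A :: "(real^'n::finite^'n) set"
  assumes irr: "\<And>W. subspace W \<Longrightarrow> (\<And>X w. X \<in> L \<Longrightarrow> w \<in> W \<Longrightarrow> X *v w \<in> W) \<Longrightarrow> W = {0} \<or> W = UNIV"
    and A: "lie_ideal A L" and abel: "\<And>a b. a \<in> A \<Longrightarrow> b \<in> A \<Longrightarrow> a ** b = b ** a"
    and "X \<in> L" "a \<in> A"
  shows "X ** a = a ** X"
proof -
  define S where "S = {lie_bracket X a |X a. X \<in> L \<and> a \<in> A}"
  have SA: "S \<subseteq> A" using A by (auto simp: S_def lie_ideal_def)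
  have "\<exists>N. \<forall>v. ((*v) b ^^ N) v = 0" if b: "b \<in> S" for b
  proof -
    obtain X a where Xa: "X \<in> L" "a \<in> A" "b = lie_bracket X a"
      using b by (auto simp: S_def)
    have "b \<in> A" using b SA by blast
    moreover have "lie_bracket X b \<in> A"
      using \<open>b \<in> A\<close> Xa A by (auto simp: lie_ideal_def)
    ultimately show ?thesis
      using Xa abel by (intro commutator_nilpotent[of b X a "lie_bracket X b"]) auto
  qed
  then obtain v where v: "v \<noteq> 0" "\<And>b. b \<in> S \<Longrightarrow> b *v v = 0"
    using common_kernel_of_commuting_nilpotents[of S] abel SA by blast
  let ?W = "{w. \<forall>b\<in>S. b *v w = 0}"
  have "X *v w \<in> ?W" if "X \<in> L" "w \<in> ?W" for X w
  proof -
    have "b *v (X *v w) = 0" if "b \<in> S" for b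
    proof -
      have "lie_bracket X b \<in> S" using \<open>b \<in> S\<close> \<open>X \<in> L\<close> SA unfolding S_def by blast
      then have "lie_bracket X b *v w = 0" using \<open>w \<in> ?W\<close> by blast
      then have "b *v (X *v w) = X *v (b *v w)"
        by (simp add: lie_bracket_def matrix_vector_mult_diff_rdistrib matrix_vector_mul_assoc)
      then show ?thesis using \<open>w \<in> ?W\<close> \<open>b \<in> S\<close> by simp
    qed
    then show ?thesis by blast
  qed
  moreover have "subspace ?W"
    by (auto simp: subspace_def matrix_vector_right_distrib matrix_vector_mult_scaleR)
  ultimately have "?W = UNIV" using irr[of ?W] v by blast
  moreover have "lie_bracket X a \<in> S" using assms by (auto simp: S_def)
  ultimately have "lie_bracket X a *v w = 0" for w by blast
  then have "lie_bracket X a = 0" by (metis matrix_eq matrix_vector_mult_0)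
  then show ?thesis by (simp add: lie_bracket_def)
qed

text \<open>
  By the Jacobi identity, \<open>[X, [U, V]]\<close> is a sum of two brackets of elements of \<open>I\<close>.
\<close>

lemma derived_algebra_ideal:
  assumes "lie_ideal I L"
  shows "lie_ideal (derived_algebra I) L"
proof -
  let ?S = "{lie_bracket X Y |X Y. X \<in> I \<and> Y \<in> I}"
  have "?S \<subseteq> I" using assms by (auto simp: lie_ideal_def)
  then have sub: "derived_algebra I \<subseteq> I"
    using assms unfolding derived_algebra_def lie_ideal_def by (intro span_minimal) auto
  moreover have "lie_bracket X Y \<in> derived_algebra I" if "X \<in> L" "Y \<in> derived_algebra I" for X Y
    using that(2) unfolding derived_algebra_def
  proof (induction rule: span_induct_alt)
    case base
    then show ?case by (simp add: lie_bracket_def span_zero)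
  next
    case (step r s Y)
    then obtain U V where UV: "U \<in> I" "V \<in> I" "s = lie_bracket U V" by blast
    have jacobi: "lie_bracket X s = lie_bracket (lie_bracket X U) V + lie_bracket U (lie_bracket X V)"
      unfolding UV lie_bracket_def
      by (simp add: matrix_mul_assoc matmul_distribs algebra_simps)
    have "lie_bracket X U \<in> I" "lie_bracket X V \<in> I"
      using UV assms \<open>X \<in> L\<close> by (auto simp: lie_ideal_def)
    then have "lie_bracket X s \<in> span ?S"
      unfolding jacobi using UV by (intro span_add; intro span_base; blast)
    moreover have "lie_bracket X (r *\<^sub>R s + Y) = r *\<^sub>R lie_bracket X s + lie_bracket X Y"
      by (simp add: lie_bracket_def matmul_distribs algebra_simps)
    ultimately show ?case using step by (simp add: span_add span_scale)
  qed
  ultimately show ?thesis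
    using assms by (auto simp: lie_ideal_def derived_algebra_def)
qed

text \<open>
  The ideal is the last nonzero term of the derived series of a nonzero solvable ideal.
\<close>

lemma nonsemisimple_abelian_ideal:
  assumes "\<not> semisimple_lie_algebra L"
  shows "\<exists>A. lie_ideal A L \<and> A \<noteq> {0} \<and> (\<forall>a\<in>A. \<forall>b\<in>A. a ** b = b ** a)"
proof -
  obtain I k where I: "lie_ideal I L" "I \<noteq> {0}" "(derived_algebra ^^ k) I = {0}"
    using assms by (auto simp: semisimple_lie_algebra_def solvable_lie_algebra_def)
  define k where "k = (LEAST k. (derived_algebra ^^ k) I = {0})"
  have k: "(derived_algebra ^^ k) I = {0}"
    unfolding k_def by (rule LeastI) (rule I(3))
  then obtain j where j: "k = Suc j" using I(2) by (cases k) auto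
  let ?A = "(derived_algebra ^^ j) I"
  have "?A \<noteq> {0}"
    using not_less_Least[of j "\<lambda>k. (derived_algebra ^^ k) I = {0}"] j unfolding k_def by auto
  moreover have "lie_ideal ((derived_algebra ^^ i) I) L" for i
    using I(1) by (induction i) (auto intro: derived_algebra_ideal)
  moreover have "a ** b = b ** a" if "a \<in> ?A" "b \<in> ?A" for a b
  proof -
    have "lie_bracket a b \<in> derived_algebra ?A"
      using that unfolding derived_algebra_def by (intro span_base) blast
    with k j show ?thesis by (simp add: lie_bracket_def)
  qed
  ultimately show ?thesis by blast
qed

section \<open>Charts and tangent spaces of an immersed matrix group\<close>

lemma matrix_inv_left_right:
  fixes a :: "real^'n::finite^'n"
  assumes "invertible a"
  shows "a ** matrix_inv a = mat 1" "matrix_inv a ** a = mat 1"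
  using assms unfolding invertible_def matrix_inv_def by (metis (mono_tags, lifting) someI_ex)+

lemma linear_projection_onto_subspace:
  fixes W :: "'a::euclidean_space set"
  assumes "subspace W"
  obtains \<pi> where "linear \<pi>" "range \<pi> \<subseteq> W" "\<And>w. w \<in> W \<Longrightarrow> \<pi> w = w"
  using linear_exists_left_inverse_on[OF linear_id assms] by auto

text \<open>
  A projection onto \<open>W\<close> fixes the curve, hence also its derivative.
\<close>

lemma has_vector_derivative_in_subspace:
  fixes W :: "'a::euclidean_space set"
  assumes "subspace W" and c: "(c has_vector_derivative u) (at t within T)" and T: "open T" "t \<in> T"
    and cW: "\<And>s. s \<in> T \<Longrightarrow> c s \<in> W"
  shows "u \<in> W"
proof -
  obtain \<pi> where \<pi>: "linear \<pi>" "range \<pi> \<subseteq> W" "\<And>w. w \<in> W \<Longrightarrow> \<pi> w = w"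
    using linear_projection_onto_subspace[OF assms(1)] by blast
  have "((\<lambda>s. \<pi> (c s)) has_vector_derivative \<pi> u) (at t within T)"
    using \<pi>(1) c by (simp add: bounded_linear.has_vector_derivative linear_conv_bounded_linear)
  then have "(c has_vector_derivative \<pi> u) (at t within T)"
    by (rule has_vector_derivative_transform[OF T(2), rotated]) (simp add: \<pi>(3) cW)
  with c have "u = \<pi> u"
    using vector_derivative_unique_at[of c u t "\<pi> u"] by (simp only: at_within_open[OF T(2,1)])
  with \<pi>(2) show ?thesis by (metis rangeI subsetD)
qed

text \<open>
  The group carries the topology of \<open>M\<close> and the coarser one of the matrix space. Group operations
  are continuous in the former, limits of matrices are taken in the latter; the inclusion into the
  matrix space is continuous, but it need not be an embedding.
\<close>

locale immersed_lie_subgroup =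
  fixes M :: "(real^'n::finite^'n, real^'n^'n) manifold" and G H :: "(real^'n^'n) set"
  assumes lie: "lie_subgroup M G H"
begin

abbreviation "E \<equiv> model M"

lemma subspace_E: "subspace E"
  using lie by (simp add: lie_subgroup_def smooth_manifold_def)

lemma topspace_M: "topspace (mtop M) = G"
  using lie by (simp add: lie_subgroup_def)

lemma one_in_G: "mat 1 \<in> G"
  and mult_in_G: "a \<in> G \<Longrightarrow> b \<in> G \<Longrightarrow> a ** b \<in> G"
  and inv_in_G: "a \<in> G \<Longrightarrow> matrix_inv a \<in> G"
  and G_in_H: "a \<in> G \<Longrightarrow> a \<in> H"
  and G_inverse: "a \<in> G \<Longrightarrow> a ** matrix_inv a = mat 1" "a \<in> G \<Longrightarrow> matrix_inv a ** a = mat 1"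
  using lie by (auto simp: lie_subgroup_def matrix_subgroup_def matrix_inv_left_right)

lemma chart_at:
  assumes "g \<in> G"
  obtains U \<phi> where "(U, \<phi>) \<in> charts M" "g \<in> U"
proof -
  have "g \<in> \<Union> (fst ` charts M)"
    using lie assms by (simp add: lie_subgroup_def smooth_manifold_def)
  then show ?thesis using that by auto
qed

lemma chart_props:
  assumes "(U, \<phi>) \<in> charts M"
  shows chart_open: "openin (mtop M) U" and chart_subset: "U \<subseteq> G"
    and chart_image_open: "openin (top_of_set E) (\<phi> ` U)" and chart_image_subset: "\<phi> ` U \<subseteq> E"
    and chart_inj: "inj_on \<phi> U"
    and chart_inv_continuous: "continuous_map (top_of_set (\<phi> ` U)) (mtop M) (inv_into U \<phi>)"
proof -
  have *: "openin (mtop M) U" "openin (top_of_set E) (\<phi> ` U)"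
    "homeomorphic_map (subtopology (mtop M) U) (top_of_set (\<phi> ` U)) \<phi>"
    using lie assms by (auto simp: lie_subgroup_def smooth_manifold_def)
  from * show "openin (mtop M) U" "openin (top_of_set E) (\<phi> ` U)" by auto
  from * show "U \<subseteq> G" "\<phi> ` U \<subseteq> E"
    using openin_subset[of "mtop M" U] openin_subset[of "top_of_set E" "\<phi> ` U"] topspace_M by auto
  then have top: "topspace (subtopology (mtop M) U) = U"
    using topspace_M by auto
  show inj: "inj_on \<phi> U"
    using homeomorphic_imp_injective_map[OF *(3)] top by simp
  obtain g where g: "homeomorphic_maps (subtopology (mtop M) U) (top_of_set (\<phi> ` U)) \<phi> g"
    using *(3) homeomorphic_map_maps by blast
  have "inv_into U \<phi> z = g z" if "z \<in> \<phi> ` U" for z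
    using g that inj top by (auto simp: homeomorphic_maps_def)
  moreover have "continuous_map (top_of_set (\<phi> ` U)) (mtop M) g"
    using g by (auto simp: homeomorphic_maps_def continuous_map_in_subtopology)
  ultimately show "continuous_map (top_of_set (\<phi> ` U)) (mtop M) (inv_into U \<phi>)"
    by (auto intro: continuous_map_eq)
qed

lemma chart_inv:
  assumes "(U, \<phi>) \<in> charts M"
  shows "x \<in> U \<Longrightarrow> inv_into U \<phi> (\<phi> x) = x"
    and "z \<in> \<phi> ` U \<Longrightarrow> inv_into U \<phi> z \<in> U"
    and "z \<in> \<phi> ` U \<Longrightarrow> \<phi> (inv_into U \<phi> z) = z"
  using chart_inj[OF assms] by (auto simp: inv_into_into f_inv_into_f)

lemma inclusion_continuous: "continuous_map (mtop M) euclidean (\<lambda>a. a)"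
  using lie by (auto simp: lie_subgroup_def immersion_def smooth_map_def euclidean_manifold_def)

lemma inv_continuous: "continuous_map (mtop M) (mtop M) matrix_inv"
  using lie by (auto simp: lie_subgroup_def smooth_map_def)

lemma mult_continuous: "continuous_map (prod_topology (mtop M) (mtop M)) (mtop M) (\<lambda>(a, b). a ** b)"
  using lie by (auto simp: lie_subgroup_def smooth_map_def prod_manifold_def)

lemma chart_inv_C1:
  assumes ch: "(U, \<phi>) \<in> charts M"
  obtains \<psi>' where "\<forall>z \<in> \<phi> ` U. (inv_into U \<phi> has_derivative \<psi>' z) (at z within \<phi> ` U)"
    and "\<forall>v \<in> E. continuous_on (\<phi> ` U) (\<lambda>z. \<psi>' z v)"
proof -
  have "smooth_on E (\<phi> ` U) (\<lambda>z. inv_into U \<phi> z)"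
    using lie ch by (auto simp: lie_subgroup_def immersion_def smooth_map_def euclidean_manifold_def)
  then have "Ck_on (Suc 0) E (\<phi> ` U) (\<lambda>z. inv_into U \<phi> z)"
    unfolding smooth_on_def by blast
  then show ?thesis using that by auto
qed

lemma line_in_cball:
  assumes "z \<in> E" "v \<in> E" "r > 0"
  shows "\<exists>\<delta>>0. \<forall>t. \<bar>t\<bar> \<le> \<delta> \<longrightarrow> z + t *\<^sub>R v \<in> cball z r \<inter> E"
proof (intro exI[of _ "r / (norm v + 1)"] conjI allI impI)
  have nv: "norm v + 1 > 0" by (simp add: add_nonneg_pos)
  then show "r / (norm v + 1) > 0" using \<open>r > 0\<close> by simp
  fix t assume "\<bar>t\<bar> \<le> r / (norm v + 1)"
  then have "\<bar>t\<bar> * norm v \<le> r / (norm v + 1) * norm v" by (intro mult_right_mono) auto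
  also have "\<dots> \<le> r" using nv \<open>r > 0\<close> by (simp add: field_simps)
  finally have "norm (t *\<^sub>R v) \<le> r" by simp
  then show "z + t *\<^sub>R v \<in> cball z r \<inter> E"
    using assms subspace_E by (simp add: subspace_add subspace_scale dist_norm)
qed

lemma chart_line_derivative:
  assumes D: "(inv_into U \<phi> has_derivative D) (at (z + t *\<^sub>R v) within \<phi> ` U)"
    and line: "\<And>s. s \<in> T \<Longrightarrow> z + s *\<^sub>R v \<in> \<phi> ` U"
  shows "((\<lambda>s. inv_into U \<phi> (z + s *\<^sub>R v)) has_vector_derivative D v) (at t within T)"
proof -
  have "((\<lambda>s. inv_into U \<phi> (z + s *\<^sub>R v)) has_derivative (\<lambda>h. D (h *\<^sub>R v))) (at t within T)"
  proof (rule has_derivative_in_compose[where f = "\<lambda>s. z + s *\<^sub>R v" and f' = "\<lambda>h. h *\<^sub>R v"])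
    show "((\<lambda>s. z + s *\<^sub>R v) has_derivative (\<lambda>h. h *\<^sub>R v)) (at t within T)"
      by (auto intro!: derivative_eq_intros)
    have "(\<lambda>s. z + s *\<^sub>R v) ` T \<subseteq> \<phi> ` U" using line by auto
    from has_derivative_subset[OF D this]
    show "(inv_into U \<phi> has_derivative D) (at (z + t *\<^sub>R v) within (\<lambda>s. z + s *\<^sub>R v) ` T)" .
  qed
  then show ?thesis
    using linear_scale[OF has_derivative_linear[OF D]] by (simp add: has_vector_derivative_def)
qed

lemma chart_matrix_continuous:
  assumes ch: "(U, \<phi>) \<in> charts M"
  shows "continuous_on (\<phi> ` U) (inv_into U \<phi>)"
    and "continuous_on (\<phi> ` U) (\<lambda>z. matrix_inv (inv_into U \<phi> z))"
proof -
  note c = chart_inv_continuous[OF ch]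
  show "continuous_on (\<phi> ` U) (inv_into U \<phi>)"
    using continuous_map_compose[OF c inclusion_continuous] by (simp add: o_def)
  show "continuous_on (\<phi> ` U) (\<lambda>z. matrix_inv (inv_into U \<phi> z))"
    using continuous_map_compose[OF continuous_map_compose[OF c inv_continuous] inclusion_continuous]
    by (simp add: o_def)
qed

text \<open>
  Differentiability of the multiplication, expressed in charts. The closed balls in the model space
  are compact, which later yields uniform bounds for the partial derivative in the first factor.
\<close>

lemma mult_in_charts_C1:
  assumes ch: "(U, \<phi>) \<in> charts M" "(V, \<eta>) \<in> charts M" "(W, \<omega>) \<in> charts M"
    and ab: "a \<in> U" "b \<in> V" "a ** b \<in> W"
  defines "m \<equiv> \<lambda>(y, z). \<omega> (inv_into U \<phi> y ** inv_into V \<eta> z)"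
  obtains r m' where "r > 0"
    and "cball (\<phi> a) r \<inter> E \<subseteq> \<phi> ` U" "cball (\<eta> b) r \<inter> E \<subseteq> \<eta> ` V"
    and "\<forall>y \<in> cball (\<phi> a) r \<inter> E. \<forall>z \<in> cball (\<eta> b) r \<inter> E.
           inv_into U \<phi> y ** inv_into V \<eta> z \<in> W"
    and "\<forall>p \<in> (cball (\<phi> a) r \<inter> E) \<times> (cball (\<eta> b) r \<inter> E).
           (m has_derivative m' p) (at p within (cball (\<phi> a) r \<inter> E) \<times> (cball (\<eta> b) r \<inter> E))"
    and "\<forall>v \<in> E.
           continuous_on ((cball (\<phi> a) r \<inter> E) \<times> (cball (\<eta> b) r \<inter> E)) (\<lambda>p. m' p (v, 0))"
proof -
  let ?\<psi> = "inv_into U \<phi>" and ?\<theta> = "inv_into V \<eta>"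
  define Q where "Q = {p \<in> \<phi> ` U \<times> \<eta> ` V. ?\<psi> (fst p) ** ?\<theta> (snd p) \<in> W}"
  have inj: "inj_on (map_prod \<phi> \<eta>) (U \<times> V)"
    using chart_inj ch by (simp add: map_prod_inj_on)
  have inv: "inv_into (U \<times> V) (map_prod \<phi> \<eta>) p = (?\<psi> (fst p), ?\<theta> (snd p))"
    if "p \<in> \<phi> ` U \<times> \<eta> ` V" for p
    using that inj chart_inv[OF ch(1)] chart_inv[OF ch(2)]
    by (intro inv_into_f_eq) (auto simp: map_prod_def split_beta)
  have Q: "Q = map_prod \<phi> \<eta> ` {x \<in> U \<times> V. (\<lambda>(a, b). a ** b) x \<in> W}"
    unfolding Q_def using chart_inv[OF ch(1)] chart_inv[OF ch(2)] by force
  have "(U \<times> V, map_prod \<phi> \<eta>) \<in> charts (prod_manifold M M)"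
    using ch by (auto simp: prod_manifold_def)
  then have "smooth_on (E \<times> E) Q (\<lambda>z. \<omega> ((\<lambda>(a, b). a ** b) (inv_into (U \<times> V) (map_prod \<phi> \<eta>) z)))"
    using lie ch(3) unfolding Q lie_subgroup_def smooth_map_def
    by (fastforce simp: prod_manifold_def)
  then have "Ck_on (Suc 0) (E \<times> E) Q
      (\<lambda>z. \<omega> ((\<lambda>(a, b). a ** b) (inv_into (U \<times> V) (map_prod \<phi> \<eta>) z)))"
    unfolding smooth_on_def by blast
  then obtain m' where m': "\<And>p. p \<in> Q \<Longrightarrow>
      ((\<lambda>z. \<omega> ((\<lambda>(a, b). a ** b) (inv_into (U \<times> V) (map_prod \<phi> \<eta>) z))) has_derivative m' p) (at p within Q)"
    and cont: "\<And>v. v \<in> E \<times> E \<Longrightarrow> continuous_on Q (\<lambda>p. m' p v)"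
    by auto
  have der: "(m has_derivative m' p) (at p within Q)" if "p \<in> Q" for p
    using m'[OF that]
    by (rule has_derivative_transform[OF that, rotated]) (auto simp: m_def inv Q_def split_beta)
  have "continuous_map (prod_topology (top_of_set (\<phi> ` U)) (top_of_set (\<eta> ` V)))
      (prod_topology (mtop M) (mtop M)) (\<lambda>p. (?\<psi> (fst p), ?\<theta> (snd p)))"
    using continuous_map_compose[OF continuous_map_fst chart_inv_continuous[OF ch(1)]]
      continuous_map_compose[OF continuous_map_snd chart_inv_continuous[OF ch(2)]]
    unfolding continuous_map_pairwise o_def fst_conv snd_conv by blast
  from continuous_map_compose[OF this mult_continuous]
  have mult: "continuous_map (prod_topology (top_of_set (\<phi> ` U)) (top_of_set (\<eta> ` V))) (mtop M)
      (\<lambda>p. ?\<psi> (fst p) ** ?\<theta> (snd p))"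
    by (simp only: o_def case_prod_conv)
  have "openin (prod_topology (top_of_set (\<phi> ` U)) (top_of_set (\<eta> ` V))) Q"
    using openin_continuous_map_preimage[OF mult chart_open[OF ch(3)]]
    by (simp add: Q_def)
  then have "\<forall>x y. (x, y) \<in> Q \<longrightarrow> (\<exists>A B. openin (top_of_set (\<phi> ` U)) A \<and>
      openin (top_of_set (\<eta> ` V)) B \<and> x \<in> A \<and> y \<in> B \<and> A \<times> B \<subseteq> Q)"
    by (simp only: openin_prod_topology_alt)
  moreover have "(\<phi> a, \<eta> b) \<in> Q"
    using ab chart_inv(1)[OF ch(1)] chart_inv(1)[OF ch(2)] by (auto simp: Q_def)
  ultimately obtain A B where AB: "openin (top_of_set (\<phi> ` U)) A" "openin (top_of_set (\<eta> ` V)) B"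
    "\<phi> a \<in> A" "\<eta> b \<in> B" "A \<times> B \<subseteq> Q"
    by meson
  have "openin (top_of_set E) A" "openin (top_of_set E) B"
    using AB openin_trans chart_image_open ch by blast+
  then obtain r1 r2 where r: "r1 > 0" "cball (\<phi> a) r1 \<inter> E \<subseteq> A" "r2 > 0" "cball (\<eta> b) r2 \<inter> E \<subseteq> B"
    using AB by (meson openin_contains_cball)
  define r where "r = min r1 r2"
  have sub: "cball (\<phi> a) r \<inter> E \<subseteq> A" "cball (\<eta> b) r \<inter> E \<subseteq> B"
    using r by (auto simp: r_def)
  let ?R = "(cball (\<phi> a) r \<inter> E) \<times> (cball (\<eta> b) r \<inter> E)"
  have R: "?R \<subseteq> Q" using sub AB by blast
  show ?thesis
  proof (rule that)
    show "r > 0" using r by (simp add: r_def)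
    show "cball (\<phi> a) r \<inter> E \<subseteq> \<phi> ` U" "cball (\<eta> b) r \<inter> E \<subseteq> \<eta> ` V"
      using sub AB openin_imp_subset by blast+
    show "\<forall>y \<in> cball (\<phi> a) r \<inter> E. \<forall>z \<in> cball (\<eta> b) r \<inter> E. ?\<psi> y ** ?\<theta> z \<in> W"
    proof (intro ballI)
      fix y z
      assume "y \<in> cball (\<phi> a) r \<inter> E" "z \<in> cball (\<eta> b) r \<inter> E"
      then have "(y, z) \<in> Q" using R by blast
      then show "?\<psi> y ** ?\<theta> z \<in> W" by (simp add: Q_def)
    qed
    show "\<forall>p \<in> ?R. (m has_derivative m' p) (at p within ?R)"
      using der has_derivative_subset R by blast
    show "\<forall>v \<in> E. continuous_on ?R (\<lambda>p. m' p (v, 0))"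
      using cont subspace_0[OF subspace_E] R continuous_on_subset by blast
  qed
qed

text \<open>
  The tangent space at \<open>g\<close> is \<open>L g\<close>: right translation by the inverse of \<open>g\<close> is smooth on \<open>M\<close> and
  moves a curve through \<open>g\<close> to a curve through the identity, whose coordinates have a derivative in
  the model space.
\<close>

lemma tangent_in_lie_algebra:
  assumes ch: "(U, \<phi>) \<in> charts M" and z: "z \<in> \<phi> ` U" and v: "v \<in> E"
    and D: "(inv_into U \<phi> has_derivative D) (at z within \<phi> ` U)"
  shows "D v ** matrix_inv (inv_into U \<phi> z) \<in> lie_algebra_of M"
proof -
  define a where "a = inv_into U \<phi> z"
  define b where "b = matrix_inv a"
  have a: "a \<in> U" "\<phi> a = z" "a \<in> G"
    using chart_inv[OF ch] z chart_subset[OF ch] by (auto simp: a_def)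
  then have b: "b \<in> G" "a ** b = mat 1"
    by (auto simp: b_def inv_in_G G_inverse)
  obtain V \<eta> where ch2: "(V, \<eta>) \<in> charts M" "b \<in> V"
    using chart_at b(1) by blast
  obtain W \<omega> where ch3: "(W, \<omega>) \<in> charts M" "mat 1 \<in> W"
    using chart_at one_in_G by blast
  have abW: "a ** b \<in> W" using b ch3 by simp
  obtain r m' where r: "r > 0" and sub: "cball (\<phi> a) r \<inter> E \<subseteq> \<phi> ` U"
    and inW0: "\<forall>y \<in> cball (\<phi> a) r \<inter> E. \<forall>w \<in> cball (\<eta> b) r \<inter> E.
           inv_into U \<phi> y ** inv_into V \<eta> w \<in> W"
    and m0: "\<forall>p \<in> (cball (\<phi> a) r \<inter> E) \<times> (cball (\<eta> b) r \<inter> E).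
           ((\<lambda>(y, z). \<omega> (inv_into U \<phi> y ** inv_into V \<eta> z)) has_derivative m' p)
             (at p within (cball (\<phi> a) r \<inter> E) \<times> (cball (\<eta> b) r \<inter> E))"
    by (rule mult_in_charts_C1[OF ch ch2(1) ch3(1) a(1) ch2(2) abW]) (rule that; assumption)
  note inW = inW0[rule_format] and m' = m0[rule_format]
  have zE: "z \<in> E" and bE: "\<eta> b \<in> E"
    using chart_image_subset ch ch2 z by blast+
  obtain \<delta> where \<delta>: "\<delta> > 0" "\<forall>t. \<bar>t\<bar> \<le> \<delta> \<longrightarrow> z + t *\<^sub>R v \<in> cball z r \<inter> E"
    using line_in_cball[OF zE v r] by blast
  define T where "T = ball (0::real) \<delta>"
  have line: "z + t *\<^sub>R v \<in> cball (\<phi> a) r \<inter> E" if "t \<in> T" for t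
    using \<delta>(2) that a(2) by (simp add: T_def)
  have bb: "\<eta> b \<in> cball (\<eta> b) r \<inter> E" using r bE by simp
  have inv_b: "inv_into V \<eta> (\<eta> b) = b" using chart_inv(1)[OF ch2(1,2)] .
  \<comment> \<open>The translated curve, in the chart at the identity.\<close>
  define c where "c t = \<omega> (inv_into U \<phi> (z + t *\<^sub>R v) ** b)" for t :: real
  define u where "u = m' (z, \<eta> b) (v, 0)"
  have T0: "0 \<in> T" "open T" using \<delta> by (auto simp: T_def)
  have "((\<lambda>t. (z + t *\<^sub>R v, \<eta> b)) has_derivative (\<lambda>t. (t *\<^sub>R v, 0))) (at 0 within T)"
    by (auto intro!: derivative_eq_intros)
  moreover have "((\<lambda>(y, z). \<omega> (inv_into U \<phi> y ** inv_into V \<eta> z)) has_derivative m' (z, \<eta> b))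
      (at (z + 0 *\<^sub>R v, \<eta> b) within (\<lambda>t. (z + t *\<^sub>R v, \<eta> b)) ` T)"
  proof -
    have "(\<lambda>t. (z + t *\<^sub>R v, \<eta> b)) ` T \<subseteq> (cball (\<phi> a) r \<inter> E) \<times> (cball (\<eta> b) r \<inter> E)"
      using line bb by blast
    moreover have "(z, \<eta> b) \<in> (cball (\<phi> a) r \<inter> E) \<times> (cball (\<eta> b) r \<inter> E)"
      using line[OF T0(1)] bb by simp
    ultimately show ?thesis using has_derivative_subset[OF m'] by simp
  qed
  ultimately have "((\<lambda>t. (\<lambda>(y, z). \<omega> (inv_into U \<phi> y ** inv_into V \<eta> z)) (z + t *\<^sub>R v, \<eta> b))
      has_derivative (\<lambda>t. m' (z, \<eta> b) (t *\<^sub>R v, 0))) (at 0 within T)"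
    by (rule has_derivative_in_compose)
  moreover have "m' (z, \<eta> b) (t *\<^sub>R v, 0) = t *\<^sub>R u" for t
  proof -
    have "linear (m' (z, \<eta> b))"
      using m'[of "(z, \<eta> b)"] line[OF T0(1)] bb by (auto intro: has_derivative_linear)
    then show ?thesis
      using linear_scale[of "m' (z, \<eta> b)" t "(v, 0)"] by (simp add: u_def)
  qed
  ultimately have c: "(c has_vector_derivative u) (at 0 within T)"
    by (simp add: has_vector_derivative_def c_def[abs_def] inv_b)
  have ct: "c t \<in> \<omega> ` W" if "t \<in> T" for t
    using inW[OF line[OF that] bb] by (auto simp: c_def inv_b)
  have c0: "c 0 = \<omega> (mat 1)" by (simp add: c_def a_def[symmetric] b)
  have "u \<in> E"
  proof (rule has_vector_derivative_in_subspace[OF subspace_E c T0(2,1)])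
    show "c t \<in> E" if "t \<in> T" for t
      using ct that chart_image_subset[OF ch3(1)] by blast
  qed
  obtain \<omega>' where \<omega>0: "\<forall>z \<in> \<omega> ` W. (inv_into W \<omega> has_derivative \<omega>' z) (at z within \<omega> ` W)"
    by (rule chart_inv_C1[OF ch3(1)]) (rule that; assumption)
  note \<omega>' = \<omega>0[rule_format]
  have "((\<lambda>t. inv_into W \<omega> (c t)) has_derivative (\<lambda>t. \<omega>' (c 0) (t *\<^sub>R u))) (at 0 within T)"
  proof (rule has_derivative_in_compose[where f = c and f' = "\<lambda>t. t *\<^sub>R u"])
    show "(c has_derivative (\<lambda>t. t *\<^sub>R u)) (at 0 within T)"
      using c by (simp add: has_vector_derivative_def)
    show "(inv_into W \<omega> has_derivative \<omega>' (c 0)) (at (c 0) within c ` T)"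
      using ct T0 by (intro has_derivative_subset[OF \<omega>']) auto
  qed
  moreover have "linear (\<omega>' (c 0))"
    by (rule has_derivative_linear[OF \<omega>'[OF ct[OF T0(1)]]])
  ultimately have 1: "((\<lambda>t. inv_into W \<omega> (c t)) has_vector_derivative \<omega>' (c 0) u) (at 0 within T)"
    by (simp add: has_vector_derivative_def linear_scale)
  have "((\<lambda>t. inv_into U \<phi> (z + t *\<^sub>R v)) has_vector_derivative D v) (at 0 within T)"
    using D line sub by (intro chart_line_derivative) auto
  then have 2: "((\<lambda>t. inv_into U \<phi> (z + t *\<^sub>R v) ** b) has_vector_derivative D v ** b) (at 0 within T)"
    by (rule bounded_linear.has_vector_derivative[OF matmul.bounded_linear_left])
  have eq: "inv_into W \<omega> (c t) = inv_into U \<phi> (z + t *\<^sub>R v) ** b" if "t \<in> T" for t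
    using chart_inv(1)[OF ch3(1)] inW[OF line[OF that] bb] by (simp add: c_def inv_b)
  have "((\<lambda>t. inv_into W \<omega> (c t)) has_vector_derivative D v ** b) (at 0 within T)"
    by (rule has_vector_derivative_transform[OF T0(1) eq 2])
  moreover have "at 0 within T = at (0::real)"
    by (rule at_within_open[OF T0])
  ultimately have Dv: "D v ** b = \<omega>' (c 0) u"
    using 1 vector_derivative_unique_at by metis
  have "\<exists>D. (inv_into W \<omega> has_derivative D) (at (\<omega> (mat 1)) within \<omega> ` W) \<and> \<omega>' (c 0) u \<in> D ` E"
    using \<omega>'[of "\<omega> (mat 1)"] ch3(2) \<open>u \<in> E\<close> by (intro exI[of _ "\<omega>' (\<omega> (mat 1))"]) (simp add: c0)
  then have "\<omega>' (c 0) u \<in> lie_algebra_of M"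
    unfolding lie_algebra_of_def mem_Collect_eq using ch3(2) by (intro bexI[OF _ ch3(1)]) simp
  with Dv show ?thesis by (simp add: a_def b_def)
qed

lemma lie_algebra_curve:
  assumes "X \<in> lie_algebra_of M"
  shows "\<exists>\<gamma> \<delta>. \<delta> > 0 \<and> (\<forall>t. \<bar>t\<bar> < \<delta> \<longrightarrow> \<gamma> t \<in> G) \<and> \<gamma> 0 = mat 1 \<and>
    (\<gamma> has_vector_derivative X) (at 0)"
proof -
  obtain U \<phi> D v where ch: "(U, \<phi>) \<in> charts M" and oneU: "mat 1 \<in> U"
    and D: "(inv_into U \<phi> has_derivative D) (at (\<phi> (mat 1)) within \<phi> ` U)"
    and v: "v \<in> E" and XD: "X = D v"
    using assms unfolding lie_algebra_of_def by auto
  define z where "z = \<phi> (mat 1)"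
  have z: "z \<in> \<phi> ` U" "z \<in> E" using oneU chart_image_subset[OF ch] by (auto simp: z_def)
  obtain r where r: "r > 0" "cball z r \<inter> E \<subseteq> \<phi> ` U"
    using chart_image_open[OF ch] z(1) unfolding openin_contains_cball by blast
  obtain \<delta> where \<delta>: "\<delta> > 0" "\<forall>t. \<bar>t\<bar> \<le> \<delta> \<longrightarrow> z + t *\<^sub>R v \<in> cball z r \<inter> E"
    using line_in_cball[OF z(2) v r(1)] by blast
  have line: "z + t *\<^sub>R v \<in> \<phi> ` U" if "t \<in> ball 0 \<delta>" for t
    using \<delta>(2) r(2) that by auto
  define \<gamma> where "\<gamma> t = inv_into U \<phi> (z + t *\<^sub>R v)" for t
  have "(\<gamma> has_vector_derivative D v) (at 0 within ball 0 \<delta>)"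
    unfolding \<gamma>_def by (rule chart_line_derivative[OF _ line]) (use D in \<open>simp_all add: z_def\<close>)
  moreover have "at 0 within ball 0 \<delta> = at (0::real)"
    using \<delta> by (intro at_within_open) auto
  ultimately have "(\<gamma> has_vector_derivative X) (at 0)" by (simp only: XD)
  moreover have "\<forall>t. \<bar>t\<bar> < \<delta> \<longrightarrow> \<gamma> t \<in> G"
    using chart_inv(2)[OF ch line] chart_subset[OF ch] by (auto simp: \<gamma>_def)
  moreover have "\<gamma> 0 = mat 1"
    using chart_inv(1)[OF ch oneU] by (simp add: \<gamma>_def z_def)
  ultimately show ?thesis using \<delta>(1) by blast
qed

end

section \<open>From the Lie algebra to the connected group\<close>

text \<open>
  Gronwall's argument: the function \<open>exp (- 2 C t) |h t|\<^sup>2\<close> is nonincreasing.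
\<close>

lemma linear_growth_vanishes:
  fixes h :: "real \<Rightarrow> 'a::real_inner"
  assumes der: "\<And>t. t \<in> {0..1} \<Longrightarrow> (h has_vector_derivative h' t) (at t within {0..1})"
    and bound: "\<And>t. t \<in> {0..1} \<Longrightarrow> norm (h' t) \<le> C * norm (h t)"
    and "h 0 = 0"
  shows "h 1 = 0"
proof -
  define u where "u t = exp (- 2 * C * t) * (h t \<bullet> h t)" for t
  define u' where "u' t = exp (- 2 * C * t) * (2 * (h t \<bullet> h' t) - 2 * C * (h t \<bullet> h t))" for t
  have "(u has_derivative (\<lambda>x. x * u' t)) (at t within {0..1})" if "t \<in> {0..1}" for t
    unfolding u_def u'_def
    using der[OF that, unfolded has_vector_derivative_def]
    by (auto intro!: derivative_eq_intros simp: algebra_simps inner_commute)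
  then obtain t where t: "t \<in> {0..1}" "u 1 - u 0 = (1 - 0) * u' t"
    using mvt_very_simple[of 0 "1::real" u "\<lambda>t x. x * u' t"] by auto
  have "h t \<bullet> h' t \<le> norm (h t) * norm (h' t)" by (rule norm_cauchy_schwarz)
  also have "\<dots> \<le> norm (h t) * (C * norm (h t))"
    using bound[OF t(1)] by (rule mult_left_mono) simp
  also have "\<dots> = C * (h t \<bullet> h t)"
    by (simp add: dot_square_norm power2_eq_square)
  finally have "u' t \<le> 0"
    unfolding u'_def by (simp add: mult_le_0_iff)
  with t \<open>h 0 = 0\<close> have "u 1 \<le> 0" by (simp add: u_def)
  then show ?thesis
    by (simp add: u_def mult_le_0_iff) (metis inner_eq_zero_iff inner_ge_zero antisym exp_gt_zero mult_le_0_iff not_less)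
qed

context immersed_lie_subgroup
begin

text \<open>
  Above a segment in a chart, the curve \<open>\<gamma>\<close> in the group satisfies \<open>\<gamma>' = X \<gamma>\<close> with \<open>X t\<close> in the Lie
  algebra. Since \<open>X\<close> is continuous it is bounded, and the growth hypothesis turns into a linear
  differential inequality for \<open>\<Phi>\<close> along \<open>\<gamma>\<close>.
\<close>

lemma chart_segment_growth:
  fixes \<Phi> :: "real^'n^'n \<Rightarrow> 'b::euclidean_space"
  assumes ch: "(U, \<phi>) \<in> charts M" and lin: "linear \<Phi>" and "C \<ge> 0"
    and growth: "\<And>X g. X \<in> lie_algebra_of M \<Longrightarrow> norm (\<Phi> (X ** g)) \<le> C * norm X * norm (\<Phi> g)"
    and seg: "\<And>t. t \<in> {0..1} \<Longrightarrow> z + t *\<^sub>R v \<in> \<phi> ` U" and v: "v \<in> E"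
    and zero: "\<Phi> (inv_into U \<phi> z) = 0"
  shows "\<Phi> (inv_into U \<phi> (z + v)) = 0"
proof -
  let ?\<psi> = "inv_into U \<phi>"
  define I where "I = {0..1::real}"
  obtain \<psi>' where \<psi>0: "\<forall>z \<in> \<phi> ` U. (?\<psi> has_derivative \<psi>' z) (at z within \<phi> ` U)"
    and cont0: "\<forall>v \<in> E. continuous_on (\<phi> ` U) (\<lambda>z. \<psi>' z v)"
    by (rule chart_inv_C1[OF ch]) (rule that; assumption)
  note \<psi>' = \<psi>0[rule_format] and cont = cont0[rule_format, OF v]
  define \<gamma> where "\<gamma> t = ?\<psi> (z + t *\<^sub>R v)" for t
  define \<gamma>' where "\<gamma>' t = \<psi>' (z + t *\<^sub>R v) v" for t
  define X where "X t = \<gamma>' t ** matrix_inv (\<gamma> t)" for t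
  have seg: "z + t *\<^sub>R v \<in> \<phi> ` U" if "t \<in> I" for t
    using that seg by (simp add: I_def)
  have \<gamma>: "(\<gamma> has_vector_derivative \<gamma>' t) (at t within I)" if t: "t \<in> I" for t
    unfolding \<gamma>_def \<gamma>'_def by (rule chart_line_derivative[OF \<psi>'[OF seg[OF t]] seg])
  have XL: "X t \<in> lie_algebra_of M" if "t \<in> I" for t
    unfolding X_def \<gamma>'_def \<gamma>_def by (rule tangent_in_lie_algebra[OF ch seg[OF that] v \<psi>'[OF seg[OF that]]])
  have X\<gamma>: "X t ** \<gamma> t = \<gamma>' t" if "t \<in> I" for t
  proof -
    have "\<gamma> t \<in> G"
      using chart_inv(2)[OF ch seg[OF that]] chart_subset[OF ch] by (auto simp: \<gamma>_def)
    then show ?thesis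
      by (simp add: X_def matrix_mul_assoc[symmetric] G_inverse)
  qed
  have line: "continuous_on I (\<lambda>t. z + t *\<^sub>R v)" "(\<lambda>t. z + t *\<^sub>R v) ` I \<subseteq> \<phi> ` U"
    using seg by (auto intro!: continuous_intros)
  have "continuous_on I X"
    unfolding X_def \<gamma>'_def \<gamma>_def
    using continuous_on_compose2[OF cont line] continuous_on_compose2[OF chart_matrix_continuous(2)[OF ch] line]
    by (intro matmul.continuous_on) auto
  then have "compact (X ` I)" by (intro compact_continuous_image) (auto simp: I_def)
  then have "\<exists>K. \<forall>x \<in> X ` I. norm x \<le> K"
    by (simp only: compact_imp_bounded bounded_iff[symmetric])
  then obtain K where K0: "\<forall>x \<in> X ` I. norm x \<le> K" ..
  have K: "norm (X t) \<le> K" if "t \<in> I" for t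
    using K0 that by blast
  have "\<Phi> (\<gamma> 1) = 0"
  proof (rule linear_growth_vanishes[where h' = "\<lambda>t. \<Phi> (\<gamma>' t)" and C = "C * K"])
    fix t :: real
    assume "t \<in> {0..1}"
    then have t: "t \<in> I" by (simp add: I_def)
    have "bounded_linear \<Phi>" using lin by (simp add: linear_conv_bounded_linear)
    from bounded_linear.has_vector_derivative[OF this \<gamma>[OF t]]
    show "((\<lambda>t. \<Phi> (\<gamma> t)) has_vector_derivative \<Phi> (\<gamma>' t)) (at t within {0..1})"
      by (simp only: I_def)
    have "norm (\<Phi> (X t ** \<gamma> t)) \<le> C * norm (X t) * norm (\<Phi> (\<gamma> t))"
      by (rule growth[OF XL[OF t]])
    also have "\<dots> \<le> C * K * norm (\<Phi> (\<gamma> t))"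
      using K[OF t] \<open>C \<ge> 0\<close> by (intro mult_right_mono mult_left_mono) auto
    finally show "norm (\<Phi> (\<gamma>' t)) \<le> C * K * norm (\<Phi> (\<gamma> t))"
      by (simp only: X\<gamma>[OF t])
  next
    show "\<Phi> (\<gamma> 0) = 0" using zero by (simp add: \<gamma>_def)
  qed
  then show ?thesis by (simp add: \<gamma>_def)
qed

lemma chart_continuous:
  assumes "(U, \<phi>) \<in> charts M"
  shows "continuous_map (subtopology (mtop M) U) (top_of_set (\<phi> ` U)) \<phi>"
proof (rule homeomorphic_imp_continuous_map)
  show "homeomorphic_map (subtopology (mtop M) U) (top_of_set (\<phi> ` U)) \<phi>"
    using lie assms by (auto simp: lie_subgroup_def smooth_manifold_def)
qed

text \<open>
  The zero set of \<open>\<Phi>\<close> is closed by continuity. It is open because every point near a zero is joined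
  to it by a segment in a chart.
\<close>

lemma vanishing_on_connected_group:
  fixes \<Phi> :: "real^'n^'n \<Rightarrow> 'b::euclidean_space"
  assumes conn: "connected_space (mtop M)" and lin: "linear \<Phi>" and "C \<ge> 0"
    and growth: "\<And>X g. X \<in> lie_algebra_of M \<Longrightarrow> norm (\<Phi> (X ** g)) \<le> C * norm X * norm (\<Phi> g)"
    and one: "\<Phi> (mat 1) = 0" and "g \<in> G"
  shows "\<Phi> g = 0"
proof -
  define Z where "Z = {g \<in> G. \<Phi> g = 0}"
  have "continuous_on UNIV \<Phi>"
    using lin by (simp add: linear_continuous_on linear_conv_bounded_linear)
  then have "continuous_map euclidean euclidean \<Phi>" by simp
  from continuous_map_compose[OF inclusion_continuous this]
  have cont: "continuous_map (mtop M) euclidean \<Phi>" by (simp only: o_def)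
  have "closedin (mtop M) Z"
    using closedin_continuous_map_preimage[OF cont, of "{0}"] by (simp add: Z_def topspace_M)
  moreover have "openin (mtop M) Z"
  proof (subst openin_subopen, intro ballI)
    fix g assume "g \<in> Z"
    then have g: "g \<in> G" "\<Phi> g = 0" by (auto simp: Z_def)
    obtain U \<phi> where ch: "(U, \<phi>) \<in> charts M" "g \<in> U"
      using chart_at[OF g(1)] by blast
    obtain r where r: "r > 0" "cball (\<phi> g) r \<inter> E \<subseteq> \<phi> ` U"
      using chart_image_open[OF ch(1)] ch(2) unfolding openin_contains_cball by blast
    define N where "N = {x \<in> U. \<phi> x \<in> ball (\<phi> g) r}"
    have "openin (subtopology (mtop M) U) {x \<in> topspace (subtopology (mtop M) U). \<phi> x \<in> \<phi> ` U \<inter> ball (\<phi> g) r}"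
      by (rule openin_continuous_map_preimage[OF chart_continuous[OF ch(1)]]) (simp add: openin_open_Int)
    moreover have "{x \<in> topspace (subtopology (mtop M) U). \<phi> x \<in> \<phi> ` U \<inter> ball (\<phi> g) r} = N"
      using chart_subset[OF ch(1)] by (auto simp: N_def topspace_M)
    ultimately have "openin (mtop M) N"
      using chart_open[OF ch(1)] openin_open_subtopology by metis
    moreover have "g \<in> N" using ch r by (simp add: N_def)
    moreover have "N \<subseteq> Z"
    proof
      fix x assume "x \<in> N"
      then have x: "x \<in> U" "\<phi> x \<in> ball (\<phi> g) r" by (auto simp: N_def)
      define v where "v = \<phi> x - \<phi> g"
      have gxE: "\<phi> g \<in> E" "\<phi> x \<in> E" using chart_image_subset[OF ch(1)] ch(2) x by auto
      then have v: "v \<in> E" using subspace_E by (simp add: v_def subspace_diff)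
      have seg: "\<phi> g + t *\<^sub>R v \<in> \<phi> ` U" if "t \<in> {0..1}" for t
      proof -
        have "norm (t *\<^sub>R v) \<le> 1 * norm v" using that by (simp add: mult_left_le_one_le)
        also have "\<dots> \<le> r" using x(2) by (simp add: v_def dist_norm norm_minus_commute)
        finally have "\<phi> g + t *\<^sub>R v \<in> cball (\<phi> g) r" by (simp add: dist_norm)
        moreover have "\<phi> g + t *\<^sub>R v \<in> E"
          using gxE v subspace_E by (simp add: subspace_add subspace_scale)
        ultimately show ?thesis using r by blast
      qed
      have zero: "\<Phi> (inv_into U \<phi> (\<phi> g)) = 0"
        using g(2) chart_inv(1)[OF ch] by simp
      have "\<Phi> (inv_into U \<phi> (\<phi> g + v)) = 0"
        by (rule chart_segment_growth[OF ch(1) lin \<open>C \<ge> 0\<close> growth seg v zero])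
      then have "\<Phi> x = 0" using chart_inv(1)[OF ch(1) x(1)] by (simp add: v_def)
      with x chart_subset[OF ch(1)] show "x \<in> Z" by (auto simp: Z_def)
    qed
    ultimately show "\<exists>T. openin (mtop M) T \<and> g \<in> T \<and> T \<subseteq> Z" by blast
  qed
  ultimately have "Z = {} \<or> Z = G"
    using conn by (auto simp: connected_space_clopen_in topspace_M)
  moreover have "mat 1 \<in> Z" using one one_in_G by (simp add: Z_def)
  ultimately show ?thesis using \<open>g \<in> G\<close> by (auto simp: Z_def)
qed

text \<open>
  The map \<open>\<Phi> g = g Z - Z g\<close> satisfies \<open>\<Phi> (X g) = X \<Phi> g\<close> for \<open>X\<close> in the Lie algebra.
\<close>

lemma commutes_with_group:
  assumes conn: "connected_space (mtop M)"
    and comm: "\<And>X. X \<in> lie_algebra_of M \<Longrightarrow> X ** Z = Z ** X" and "g \<in> G"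
  shows "g ** Z = Z ** g"
proof -
  from matmul.pos_bounded obtain C where
    C0: "C > 0 \<and> (\<forall>(A :: real^'n^'n) (B :: real^'n^'n). norm (A ** B) \<le> norm A * norm B * C)" ..
  note C = C0[THEN conjunct1] C0[THEN conjunct2, rule_format]
  define \<Phi> where "\<Phi> g = g ** Z - Z ** g" for g
  have "\<Phi> g = 0"
  proof (rule vanishing_on_connected_group[OF conn _ _ _ _ \<open>g \<in> G\<close>, where C = C])
    show "linear \<Phi>"
      by (rule linearI) (simp_all add: \<Phi>_def matmul_distribs algebra_simps)
    show "norm (\<Phi> (X ** g)) \<le> C * norm X * norm (\<Phi> g)" if "X \<in> lie_algebra_of M" for X g
    proof -
      have "\<Phi> (X ** g) = X ** \<Phi> g"
        using comm[OF that] by (simp add: \<Phi>_def matmul_distribs matrix_mul_assoc)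
      then show ?thesis using C(2)[of X "\<Phi> g"] by (simp add: mult_ac)
    qed
    show "\<Phi> (mat 1) = 0" by (simp add: \<Phi>_def)
  qed (use C in simp)
  then show ?thesis by (simp add: \<Phi>_def)
qed

text \<open>
  With a projection \<open>P\<close> onto \<open>W\<close> and \<open>Q = 1 - P\<close>, invariance of \<open>W\<close> under \<open>g\<close> means \<open>Q g P = 0\<close>. As
  \<open>Q X P = 0\<close> for \<open>X\<close> in the Lie algebra, \<open>\<Phi> g = Q g P\<close> satisfies \<open>\<Phi> (X g) = Q X \<Phi> g\<close>.
\<close>

lemma invariant_under_group:
  assumes conn: "connected_space (mtop M)" and W: "subspace W"
    and inv: "\<And>X w. X \<in> lie_algebra_of M \<Longrightarrow> w \<in> W \<Longrightarrow> X *v w \<in> W"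
    and "g \<in> G" "w \<in> W"
  shows "g *v w \<in> W"
proof -
  obtain \<pi> where \<pi>: "linear \<pi>" "range \<pi> \<subseteq> W" "\<And>w. w \<in> W \<Longrightarrow> \<pi> w = w"
    using linear_projection_onto_subspace[OF W] by blast
  define P where "P = matrix \<pi>"
  have P: "P *v x = \<pi> x" for x using \<pi>(1) by (simp add: P_def matrix_works)
  define Q where "Q = mat 1 - P"
  have Q: "Q *v x = x - \<pi> x" for x by (simp add: Q_def P matrix_vector_mult_diff_rdistrib)
  from matmul.pos_bounded obtain C where
    C0: "C > 0 \<and> (\<forall>(A :: real^'n^'n) (B :: real^'n^'n). norm (A ** B) \<le> norm A * norm B * C)" ..
  note C = C0[THEN conjunct1] C0[THEN conjunct2, rule_format]
  define \<Phi> where "\<Phi> g = Q ** g ** P" for g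
  have "\<Phi> g = 0"
  proof (rule vanishing_on_connected_group[OF conn _ _ _ _ \<open>g \<in> G\<close>, where C = "norm Q * C * C"])
    show "linear \<Phi>"
      by (rule linearI) (simp_all add: \<Phi>_def matmul_distribs)
    show "norm (\<Phi> (X ** g)) \<le> norm Q * C * C * norm X * norm (\<Phi> g)" if X: "X \<in> lie_algebra_of M" for X g
    proof -
      have "Q *v (X *v (P *v y)) = 0" for y
        using inv[OF X] \<pi> by (simp add: Q P range_subsetD)
      then have "Q ** X ** P = 0"
        by (simp add: matrix_eq matrix_vector_mul_assoc matrix_mul_assoc)
      then have "Q ** X ** P ** g ** P = 0" by simp
      moreover have "Q ** X ** Q ** g ** P = Q ** X ** g ** P - Q ** X ** P ** g ** P"
        by (simp add: Q_def matmul_distribs)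
      ultimately have "\<Phi> (X ** g) = (Q ** X) ** \<Phi> g"
        by (simp add: \<Phi>_def matrix_mul_assoc)
      then have "norm (\<Phi> (X ** g)) \<le> norm (Q ** X) * norm (\<Phi> g) * C" by (simp only: C(2))
      also have "\<dots> \<le> (norm Q * norm X * C) * norm (\<Phi> g) * C"
        using C by (intro mult_right_mono) auto
      finally show ?thesis by (simp add: mult_ac)
    qed
    have "Q *v (P *v y) = 0" for y using \<pi> by (simp add: Q P range_subsetD)
    then show "\<Phi> (mat 1) = 0" by (simp add: \<Phi>_def matrix_eq matrix_vector_mul_assoc)
  qed (use C in simp)
  then have "Q *v (g *v (P *v w)) = 0" by (simp add: \<Phi>_def matrix_vector_mul_assoc matrix_mul_assoc)
  then have "g *v w = \<pi> (g *v w)" using \<pi>(3)[OF \<open>w \<in> W\<close>] by (simp add: P Q)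
  with \<pi>(2) show ?thesis by (metis rangeI subsetD)
qed

end

section \<open>Central one-parameter subgroups\<close>

abbreviation matpow :: "real^'n::finite^'n \<Rightarrow> nat \<Rightarrow> real^'n^'n" where
  "matpow a k \<equiv> ((**) a ^^ k) (mat 1)"

text \<open>
  Each further factor \<open>a\<close> multiplies \<open>C |a\<^sup>k - 1| + 1\<close> by at most \<open>1 + C |a - 1|\<close>. The matrix
  norm is submultiplicative up to the factor \<open>C\<close>.
\<close>

lemma matpow_near_one:
  fixes a :: "real^'n::finite^'n"
  assumes C: "C > 0" "\<And>(A :: real^'n^'n) (B :: real^'n^'n). norm (A ** B) \<le> norm A * norm B * C"
  shows "C * norm (matpow a k - mat 1) + 1 \<le> exp (real k * (C * norm (a - mat 1)))"
proof (induction k)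
  case (Suc k)
  let ?e = "C * norm (a - mat 1)" and ?p = "matpow a k - mat 1"
  have "matpow a (Suc k) - mat 1 = (a - mat 1) ** ?p + (a - mat 1) + ?p"
    by (simp add: matmul_distribs)
  then have "norm (matpow a (Suc k) - mat 1) \<le> norm ((a - mat 1) ** ?p) + norm (a - mat 1) + norm ?p"
    by (metis (no_types, lifting) norm_triangle_ineq norm_triangle_mono order_refl)
  also have "\<dots> \<le> norm (a - mat 1) * norm ?p * C + norm (a - mat 1) + norm ?p"
    using C(2) by simp
  finally have "C * norm (matpow a (Suc k) - mat 1)
      \<le> C * (norm (a - mat 1) * norm ?p * C + norm (a - mat 1) + norm ?p)"
    using C(1) by simp
  then have "C * norm (matpow a (Suc k) - mat 1) + 1 \<le> (1 + ?e) * (C * norm ?p + 1)"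
    by (simp add: algebra_simps)
  also have "\<dots> \<le> exp ?e * exp (real k * ?e)"
    using Suc C(1) by (intro mult_mono exp_ge_add_one_self) auto
  also have "\<dots> = exp (real (Suc k) * ?e)"
    by (simp add: exp_add[symmetric] algebra_simps)
  finally show ?case .
qed simp

text \<open>
  The quotient \<open>d s = F (- s) \<gamma> s\<close> has derivative 0 at 0, so \<open>|d s - 1|\<close> is of smaller order than \<open>s\<close>
  and \<open>d (t/n)\<^sup>n\<close> tends to 1. By commutation \<open>\<gamma> (t/n)\<^sup>n = F t d (t/n)\<^sup>n\<close>.
\<close>

lemma one_parameter_power_limit:
  fixes F \<gamma> :: "real \<Rightarrow> real^'n::finite^'n"
  assumes F: "\<And>s t. F (s + t) = F s ** F t" "F 0 = mat 1"
    and F': "(F has_vector_derivative X) (at 0)" and \<gamma>': "(\<gamma> has_vector_derivative X) (at 0)"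
    and \<gamma>0: "\<gamma> 0 = mat 1" and comm: "\<And>s. \<bar>s\<bar> \<le> t \<Longrightarrow> \<gamma> s ** F (- s) = F (- s) ** \<gamma> s" and "t > 0"
  shows "(\<lambda>n. matpow (\<gamma> (t / real (Suc n))) (Suc n)) \<longlonglongrightarrow> F t"
proof -
  from matmul.pos_bounded obtain C where
    C0: "C > 0 \<and> (\<forall>(A :: real^'n^'n) (B :: real^'n^'n). norm (A ** B) \<le> norm A * norm B * C)" ..
  note C = C0[THEN conjunct1] C0[THEN conjunct2, rule_format]
  define d where "d s = F (- s) ** \<gamma> s" for s
  have "((\<lambda>s. F (- s)) has_vector_derivative - X) (at 0)"
  proof -
    have u: "((\<lambda>s. - s) has_vector_derivative - 1) (at (0::real))"
      by (auto intro!: derivative_eq_intros)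
    from vector_diff_chain_at[OF u, of F X] F' show ?thesis by (simp add: o_def)
  qed
  from matmul.has_vector_derivative[OF this \<gamma>']
  have "(d has_vector_derivative (F (- 0) ** X + - X ** \<gamma> 0)) (at 0)"
    by (simp only: d_def[abs_def])
  then have d': "(d has_vector_derivative 0) (at 0)"
    by (simp add: F(2) \<gamma>0 matmul_distribs)
  have d0: "d 0 = mat 1" by (simp add: d_def F(2) \<gamma>0)
  define s where "s n = t / real (Suc n)" for n
  have s: "s n > 0" "real (Suc n) * s n = t" "\<bar>s n\<bar> \<le> t" for n
    using \<open>t > 0\<close> by (auto simp: s_def field_simps)
  have s_lim: "filterlim s (at 0) sequentially"
  proof (rule filterlim_atI)
    have "(\<lambda>n. t * inverse (real (Suc n))) \<longlonglongrightarrow> t * 0"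
      by (intro tendsto_intros LIMSEQ_inverse_real_of_nat)
    then show "s \<longlonglongrightarrow> 0" by (simp add: s_def[abs_def] divide_inverse)
    show "\<forall>\<^sub>F n in sequentially. s n \<noteq> 0" using s(1) by (auto intro!: always_eventually simp: less_imp_neq[symmetric])
  qed
  have "((\<lambda>y. norm ((d y - d 0) - (y - 0) *\<^sub>R 0) / norm (y - 0)) \<longlongrightarrow> 0) (at 0)"
    using d' unfolding has_vector_derivative_def has_derivative_iff_norm by blast
  then have "((\<lambda>y. norm (d y - mat 1) / norm y) \<longlongrightarrow> 0) (at 0)"
    by (simp add: d0)
  then have e: "(\<lambda>n. norm (d (s n) - mat 1) / norm (s n)) \<longlonglongrightarrow> 0"
    by (rule filterlim_compose[OF _ s_lim])
  have "norm (d (s n) - mat 1) / norm (s n) * t = real (Suc n) * norm (d (s n) - mat 1)" for n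
    using s(1)[of n] s(2)[of n, symmetric] by simp
  with tendsto_mult_left_zero[OF e, of t]
  have "(\<lambda>n. real (Suc n) * norm (d (s n) - mat 1)) \<longlonglongrightarrow> 0"
    by simp
  then have "(\<lambda>n. exp (C * (real (Suc n) * norm (d (s n) - mat 1)))) \<longlonglongrightarrow> exp (C * 0)"
    by (intro tendsto_intros)
  from tendsto_divide[OF tendsto_diff[OF this tendsto_const[of 1]] tendsto_const[of C]] C(1)
  have up: "(\<lambda>n. (exp (C * (real (Suc n) * norm (d (s n) - mat 1))) - 1) / C) \<longlonglongrightarrow> (exp (C * 0) - 1) / C"
    by (simp only: less_imp_neq[symmetric] simp_thms)
  have "(\<lambda>n. norm (matpow (d (s n)) (Suc n) - mat 1)) \<longlonglongrightarrow> 0"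
  proof (rule tendsto_sandwich[OF _ _ tendsto_const])
    show "\<forall>\<^sub>F n in sequentially. 0 \<le> norm (matpow (d (s n)) (Suc n) - mat 1)" by simp
    show "\<forall>\<^sub>F n in sequentially. norm (matpow (d (s n)) (Suc n) - mat 1)
        \<le> (exp (C * (real (Suc n) * norm (d (s n) - mat 1))) - 1) / C"
    proof (rule always_eventually, rule allI)
      fix n
      have "C * norm (matpow (d (s n)) (Suc n) - mat 1) + 1
          \<le> exp (real (Suc n) * (C * norm (d (s n) - mat 1)))"
        by (rule matpow_near_one[OF C])
      also have "real (Suc n) * (C * norm (d (s n) - mat 1)) = C * (real (Suc n) * norm (d (s n) - mat 1))"
        by (simp only: mult.left_commute)
      finally show "norm (matpow (d (s n)) (Suc n) - mat 1)
        \<le> (exp (C * (real (Suc n) * norm (d (s n) - mat 1))) - 1) / C"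
        using C(1) by (simp add: pos_le_divide_eq mult.commute[of C "norm _"])
    qed
    show "(\<lambda>n. (exp (C * (real (Suc n) * norm (d (s n) - mat 1))) - 1) / C) \<longlonglongrightarrow> 0"
      using up by simp
  qed
  then have pow_lim: "(\<lambda>n. matpow (d (s n)) (Suc n)) \<longlonglongrightarrow> mat 1"
    by (simp only: tendsto_norm_zero_iff LIM_zero_iff)
  have Fd: "matpow (\<gamma> (s n)) k = F (real k * s n) ** matpow (d (s n)) k" for n k
  proof -
    have inv: "F (s n) ** F (- s n) = mat 1"
      using F(1)[of "s n" "- s n"] F(2) by simp
    have \<gamma>: "\<gamma> (s n) = F (s n) ** d (s n)"
      by (simp add: d_def matrix_mul_assoc inv)
    have "d (s n) ** F (s n) = F (s n) ** d (s n)"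
    proof -
      have "F (- s n) ** F (s n) = mat 1" using F(1)[of "- s n" "s n"] F(2) by simp
      have "d (s n) ** F (s n) = \<gamma> (s n) ** (F (- s n) ** F (s n))"
        using comm[OF s(3)[of n]] by (simp add: d_def matrix_mul_assoc)
      also have "\<dots> = F (s n) ** d (s n)"
        using \<open>F (- s n) ** F (s n) = mat 1\<close> \<gamma> by simp
      finally show ?thesis .
    qed
    then have Fk: "d (s n) ** F (real k * s n) = F (real k * s n) ** d (s n)" for k
    proof (induction k)
      case (Suc k)
      have "F (real (Suc k) * s n) = F (s n) ** F (real k * s n)"
        by (simp add: F(1)[symmetric] algebra_simps)
      then show ?case using Suc by (metis matrix_mul_assoc)
    qed (simp add: F(2))
    show ?thesis
    proof (induction k)
      case (Suc k)
      have "matpow (\<gamma> (s n)) (Suc k) = \<gamma> (s n) ** (F (real k * s n) ** matpow (d (s n)) k)"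
        by (simp add: Suc)
      also have "\<dots> = F (s n) ** (d (s n) ** F (real k * s n)) ** matpow (d (s n)) k"
        by (simp only: \<gamma> matrix_mul_assoc)
      also have "\<dots> = (F (s n) ** F (real k * s n)) ** (d (s n) ** matpow (d (s n)) k)"
        by (simp only: Fk) (simp only: matrix_mul_assoc)
      also have "F (s n) ** F (real k * s n) = F (real (Suc k) * s n)"
        by (simp add: F(1)[symmetric] algebra_simps)
      finally show ?case by simp
    qed (simp add: F(2))
  qed
  have "(\<lambda>n. F t ** matpow (d (s n)) (Suc n)) \<longlonglongrightarrow> F t ** mat 1"
    by (rule matmul.tendsto[OF tendsto_const pow_lim])
  moreover have "(\<lambda>n. matpow (\<gamma> (s n)) (Suc n)) = (\<lambda>n. F t ** matpow (d (s n)) (Suc n))"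
    by (rule ext) (subst Fd, simp only: s(2))
  ultimately show ?thesis
    unfolding s_def[symmetric] by (simp only: matrix_mul_rid)
qed

context immersed_lie_subgroup
begin

text \<open>
  Convergence of \<open>\<gamma> (t/n)\<^sup>n\<close> to \<open>F t\<close> among the matrices does not suffice, as \<open>G\<close> need not be closed
  there. Let \<open>m\<close> be the multiplication in a chart at the identity, whose coordinate is \<open>z0\<close>. From
  \<open>m (z0, z) = z\<close> and a bound \<open>C\<close> for the derivative of \<open>s \<mapsto> m (z0 + s v, z)\<close> it follows that
  multiplication by \<open>\<gamma> s\<close> moves coordinates by at most \<open>C s\<close>. So all partial products of \<open>\<gamma> (t/n)\<^sup>n\<close>
  have coordinates in the ball of radius \<open>C t\<close>. For small \<open>t\<close> this ball is compact in the chart, and a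
  convergent subsequence of coordinates exhibits \<open>F t\<close> as an element of \<open>G\<close>.
\<close>

lemma one_parameter_small:
  assumes X: "X \<in> lie_algebra_of M"
    and F: "\<And>s t. F (s + t) = F s ** F t" "F 0 = mat 1" "(F has_vector_derivative X) (at 0)"
    and comm: "\<And>g t. g \<in> G \<Longrightarrow> g ** F t = F t ** g"
  shows "\<exists>\<delta>>0. \<forall>t. 0 < t \<and> t \<le> \<delta> \<longrightarrow> F t \<in> G"
proof -
  obtain U \<phi> D v where ch: "(U, \<phi>) \<in> charts M" and oneU: "mat 1 \<in> U"
    and D: "(inv_into U \<phi> has_derivative D) (at (\<phi> (mat 1)) within \<phi> ` U)"
    and v: "v \<in> E" and XD: "X = D v"
    using X unfolding lie_algebra_of_def by auto
  let ?\<psi> = "inv_into U \<phi>"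
  define z0 where "z0 = \<phi> (mat 1)"
  have z0: "z0 \<in> E" "?\<psi> z0 = mat 1"
    using chart_image_subset[OF ch] oneU chart_inv(1)[OF ch oneU] by (auto simp: z0_def)
  have one: "mat 1 ** mat 1 \<in> U" using oneU by simp
  define m where "m = (\<lambda>(y, z). \<phi> (?\<psi> y ** ?\<psi> z))"
  obtain r m' where r: "r > 0" and sub0: "cball (\<phi> (mat 1)) r \<inter> E \<subseteq> \<phi> ` U"
    and inU0: "\<forall>y \<in> cball (\<phi> (mat 1)) r \<inter> E. \<forall>w \<in> cball (\<phi> (mat 1)) r \<inter> E. ?\<psi> y ** ?\<psi> w \<in> U"
    and m0: "\<forall>p \<in> (cball (\<phi> (mat 1)) r \<inter> E) \<times> (cball (\<phi> (mat 1)) r \<inter> E).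
           ((\<lambda>(y, z). \<phi> (?\<psi> y ** ?\<psi> z)) has_derivative m' p)
             (at p within (cball (\<phi> (mat 1)) r \<inter> E) \<times> (cball (\<phi> (mat 1)) r \<inter> E))"
    and cont0: "\<forall>v \<in> E. continuous_on ((cball (\<phi> (mat 1)) r \<inter> E) \<times> (cball (\<phi> (mat 1)) r \<inter> E)) (\<lambda>p. m' p (v, 0))"
    by (rule mult_in_charts_C1[OF ch ch ch oneU oneU one]) (rule that; assumption)
  define B where "B = cball z0 r \<inter> E"
  note sub = sub0[folded z0_def, folded B_def] and inU = inU0[folded z0_def, folded B_def, rule_format]
    and m' = m0[folded z0_def, folded B_def, folded m_def, rule_format]
    and cont = cont0[folded z0_def, folded B_def, rule_format, OF v]
  have "compact B" unfolding B_def by (intro compact_Int_closed compact_cball closed_subspace subspace_E)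
  obtain \<delta> where \<delta>: "\<delta> > 0" and line0: "\<forall>t. \<bar>t\<bar> \<le> \<delta> \<longrightarrow> z0 + t *\<^sub>R v \<in> cball z0 r \<inter> E"
    using line_in_cball[OF z0(1) v r] by blast
  note line = line0[folded B_def, rule_format]
  have z0B: "z0 \<in> B" using line[of 0] \<delta> by simp
  define \<gamma> where "\<gamma> s = ?\<psi> (z0 + s *\<^sub>R v)" for s
  have \<gamma>G: "\<gamma> s \<in> G" if "\<bar>s\<bar> \<le> \<delta>" for s
    using chart_inv(2)[OF ch, of "z0 + s *\<^sub>R v"] sub line[OF that] chart_subset[OF ch]
    by (auto simp: \<gamma>_def)
  \<comment> \<open>The derivative of \<open>s \<mapsto> m (z0 + s v, z)\<close> at \<open>p = (s, z)\<close>.\<close>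
  define w where "w p = m' (z0 + fst p *\<^sub>R v, snd p) (v, 0)" for p :: "real \<times> _"
  have "continuous_on ({0..\<delta>} \<times> B) w"
    unfolding w_def
  proof (rule continuous_on_compose2[OF cont])
    show "continuous_on ({0..\<delta>} \<times> B) (\<lambda>p. (z0 + fst p *\<^sub>R v, snd p))"
      by (intro continuous_intros)
    show "(\<lambda>p. (z0 + fst p *\<^sub>R v, snd p)) ` ({0..\<delta>} \<times> B) \<subseteq> B \<times> B"
      using line by auto
  qed
  then have "compact (w ` ({0..\<delta>} \<times> B))"
    using \<open>compact B\<close> by (intro compact_continuous_image compact_Times) auto
  then have "\<exists>K. \<forall>x \<in> w ` ({0..\<delta>} \<times> B). norm x \<le> K"
    by (simp only: compact_imp_bounded bounded_iff[symmetric])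
  then obtain K where K0: "\<forall>x \<in> w ` ({0..\<delta>} \<times> B). norm x \<le> K" ..
  \<comment> \<open>The maximum makes the bound positive, so that one may divide by it.\<close>
  define C where "C = max K 1"
  have C: "C > 0" "norm (w (s, z)) \<le> C" if "s \<in> {0..\<delta>}" "z \<in> B" for s z
    using K0 that by (auto simp: C_def le_max_iff_disj)
  then have "C > 0" using \<delta> z0B by (meson atLeastAtMost_iff less_imp_le order_refl)
  have step: "norm (m (z0 + s *\<^sub>R v, z) - z) \<le> C * s" if s: "s \<in> {0..\<delta>}" and z: "z \<in> B" for s z
  proof -
    let ?f = "\<lambda>s. m (z0 + s *\<^sub>R v, z)"
    have "norm (?f s - ?f 0) \<le> C * norm (s - 0)"
    proof (rule differentiable_bound[where S = "{0..\<delta>}" and f' = "\<lambda>s h. h *\<^sub>R w (s, z)"])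
      fix x assume x: "x \<in> {0..\<delta>}"
      have p: "(z0 + x *\<^sub>R v, z) \<in> B \<times> B" using line x z by auto
      have "((\<lambda>s. m (z0 + s *\<^sub>R v, z)) has_derivative (\<lambda>h. m' (z0 + x *\<^sub>R v, z) (h *\<^sub>R v, 0))) (at x within {0..\<delta>})"
      proof (rule has_derivative_in_compose[where f = "\<lambda>s. (z0 + s *\<^sub>R v, z)" and f' = "\<lambda>h. (h *\<^sub>R v, 0)"])
        show "((\<lambda>s. (z0 + s *\<^sub>R v, z)) has_derivative (\<lambda>h. (h *\<^sub>R v, 0))) (at x within {0..\<delta>})"
          by (auto intro!: derivative_eq_intros)
        show "(m has_derivative m' (z0 + x *\<^sub>R v, z))
            (at (z0 + x *\<^sub>R v, z) within (\<lambda>s. (z0 + s *\<^sub>R v, z)) ` {0..\<delta>})"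
          using line z by (intro has_derivative_subset[OF m'[OF p]]) auto
      qed
      moreover have "m' (z0 + x *\<^sub>R v, z) (h *\<^sub>R v, 0) = h *\<^sub>R w (x, z)" for h
        using linear_scale[OF has_derivative_linear[OF m'[OF p]], of h "(v, 0)"]
        by (simp add: w_def)
      ultimately show "(?f has_derivative (\<lambda>h. h *\<^sub>R w (x, z))) (at x within {0..\<delta>})" by simp
      show "onorm (\<lambda>h. h *\<^sub>R w (x, z)) \<le> C"
        using C(2)[OF x z] by (intro onorm_le) (auto simp: mult.commute[of C] intro!: mult_left_mono)
    qed (use s in auto)
    moreover have "?f 0 = z"
      using z sub chart_inv(3)[OF ch, of z] by (auto simp: m_def z0)
    ultimately show ?thesis using s by simp
  qed
  have m_mult: "?\<psi> (m (y, z)) = ?\<psi> y ** ?\<psi> z" "m (y, z) \<in> E" if "y \<in> B" "z \<in> B" for y z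
    using inU[OF that] chart_inv(1)[OF ch] chart_image_subset[OF ch] by (auto simp: m_def)
  \<comment> \<open>For \<open>t \<le> \<epsilon>\<close> the curve is defined up to \<open>t\<close> and the ball of radius \<open>C t\<close> is inside the chart.\<close>
  define \<epsilon> where "\<epsilon> = min \<delta> (r / C)"
  have \<epsilon>: "\<epsilon> > 0" "\<epsilon> \<le> \<delta>" "C * \<epsilon> \<le> r"
    using \<delta> r \<open>C > 0\<close> by (auto simp: \<epsilon>_def min_def field_simps)
  have "F t \<in> G" if t: "0 < t" "t \<le> \<epsilon>" for t
  proof -
    have "\<exists>z \<in> B. ?\<psi> z = matpow (\<gamma> (t / real (Suc n))) (Suc n)" for n
    proof -
      define s where "s = t / real (Suc n)"
      have s: "s \<ge> 0" "s \<le> t" "real (Suc n) * s = t"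
        using t by (auto simp: s_def field_simps)
      then have s\<delta>: "s \<in> {0..\<delta>}" using t \<epsilon> by simp
      have sB: "z0 + s *\<^sub>R v \<in> B" using line[of s] s\<delta> by simp
      have "\<exists>z \<in> B. norm (z - z0) \<le> C * (real k * s) \<and> ?\<psi> z = matpow (\<gamma> s) k" if "k \<le> Suc n" for k
        using that
      proof (induction k)
        case 0
        show ?case using z0 z0B by (intro bexI[of _ z0]) auto
      next
        case (Suc k)
        then obtain z where z: "z \<in> B" "norm (z - z0) \<le> C * (real k * s)" "?\<psi> z = matpow (\<gamma> s) k"
          by auto
        let ?z = "m (z0 + s *\<^sub>R v, z)"
        have "norm (?z - z0) \<le> norm (?z - z) + norm (z - z0)"
          using norm_triangle_ineq[of "?z - z" "z - z0"] by simp
        also have "\<dots> \<le> C * s + C * (real k * s)"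
          using step[OF s\<delta> z(1)] z(2) by simp
        also have "\<dots> = C * (real (Suc k) * s)" by (simp add: algebra_simps)
        finally have n: "norm (?z - z0) \<le> C * (real (Suc k) * s)" .
        also have "\<dots> \<le> C * (real (Suc n) * s)"
          using Suc.prems \<open>C > 0\<close> s(1) by (intro mult_left_mono mult_right_mono) auto
        also have "\<dots> \<le> C * \<epsilon>" using s(3) t \<open>C > 0\<close> by simp
        also have "\<dots> \<le> r" by (rule \<epsilon>(3))
        finally have "?z \<in> B"
          using m_mult(2)[OF sB z(1)] by (simp add: B_def dist_norm norm_minus_commute)
        moreover have "?\<psi> ?z = matpow (\<gamma> s) (Suc k)"
          using m_mult(1)[OF sB z(1)] z(3) by (simp add: \<gamma>_def)
        ultimately show ?case using n by blast
      qed
      from this[OF order_refl] show ?thesis by (auto simp: s_def)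
    qed
    then have "\<exists>z. \<forall>n. z n \<in> B \<and> ?\<psi> (z n) = matpow (\<gamma> (t / real (Suc n))) (Suc n)"
      by (intro choice allI) (simp only: Bex_def)
    then obtain z where z: "\<forall>n. z n \<in> B \<and> ?\<psi> (z n) = matpow (\<gamma> (t / real (Suc n))) (Suc n)" ..
    then have zB: "\<forall>n. z n \<in> B" and z\<psi>: "(\<lambda>n. ?\<psi> (z n)) = (\<lambda>n. matpow (\<gamma> (t / real (Suc n))) (Suc n))"
      by auto
    obtain l \<sigma> where l: "l \<in> B" "strict_mono (\<sigma> :: nat \<Rightarrow> nat)" "(z \<circ> \<sigma>) \<longlonglongrightarrow> l"
      using \<open>compact B\<close> zB unfolding compact_def by metis
    have "continuous_on B ?\<psi>"
      using chart_matrix_continuous(1)[OF ch] sub by (rule continuous_on_subset)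
    from continuous_on_tendsto_compose[OF this l(3) l(1)]
    have "(\<lambda>n. ?\<psi> ((z \<circ> \<sigma>) n)) \<longlonglongrightarrow> ?\<psi> l"
      using zB by simp
    moreover have lim: "(\<lambda>n. matpow (\<gamma> (t / real (Suc n))) (Suc n)) \<longlonglongrightarrow> F t"
    proof (rule one_parameter_power_limit[OF F(1,2,3)])
      have T: "open (ball (0::real) \<delta>)" "0 \<in> ball (0::real) \<delta>" using \<delta> by auto
      have "(?\<psi> has_derivative D) (at (z0 + 0 *\<^sub>R v) within \<phi> ` U)" using D by (simp add: z0_def)
      moreover have "z0 + s *\<^sub>R v \<in> \<phi> ` U" if "s \<in> ball 0 \<delta>" for s using line[of s] sub that by auto
      ultimately have "(\<gamma> has_vector_derivative X) (at 0 within ball 0 \<delta>)"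
        unfolding \<gamma>_def XD by (rule chart_line_derivative)
      then show "(\<gamma> has_vector_derivative X) (at 0)"
        by (simp only: at_within_open[OF T(2,1)])
      show "\<gamma> 0 = mat 1" by (simp add: \<gamma>_def z0)
      show "\<gamma> s ** F (- s) = F (- s) ** \<gamma> s" if "\<bar>s\<bar> \<le> t" for s
        using comm \<gamma>G[of s] that t \<epsilon> by simp
    qed (rule t)
    have "(\<lambda>n. ?\<psi> ((z \<circ> \<sigma>) n)) \<longlonglongrightarrow> F t"
      using LIMSEQ_subseq_LIMSEQ[OF lim l(2)] unfolding z\<psi>[symmetric] by (simp only: o_def)
    ultimately have "F t = ?\<psi> l" by (metis LIMSEQ_unique)
    then show ?thesis
      using chart_inv(2)[OF ch, of l] l(1) sub chart_subset[OF ch] by auto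
  qed
  with \<epsilon>(1) show ?thesis by blast
qed

text \<open>
  Every \<open>F t\<close> is a power of some \<open>F s\<close> with small \<open>s > 0\<close>, or the inverse of such a power.
\<close>

lemma one_parameter_in_group:
  assumes X: "X \<in> lie_algebra_of M"
    and F: "\<And>s t. F (s + t) = F s ** F t" "F 0 = mat 1" "(F has_vector_derivative X) (at 0)"
    and comm: "\<And>g t. g \<in> G \<Longrightarrow> g ** F t = F t ** g"
  shows "F t \<in> G"
proof -
  have "\<exists>\<delta>>0. \<forall>t. 0 < t \<and> t \<le> \<delta> \<longrightarrow> F t \<in> G"
    by (rule one_parameter_small[OF X F comm])
  then obtain \<delta> where \<delta>: "\<delta> > 0" "\<forall>t. 0 < t \<and> t \<le> \<delta> \<longrightarrow> F t \<in> G" by (elim exE conjE)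
  have mult: "F (real k * s) \<in> G" if "F s \<in> G" for k s
  proof (induction k)
    case (Suc k)
    have "F (real (Suc k) * s) = F s ** F (real k * s)"
      by (simp add: F(1)[symmetric] algebra_simps)
    then show ?case using Suc that mult_in_G by simp
  qed (simp add: F(2) one_in_G)
  have pos: "F t \<in> G" if "t > 0" for t
  proof -
    obtain n where n: "real n > t / \<delta>" using reals_Archimedean2 by blast
    have "t / \<delta> > 0" using that \<delta> by simp
    then have "n > 0" using n by (metis gr0I not_less_iff_gr_or_eq of_nat_0 order.strict_trans)
    then have "0 < t / real n" "t / real n \<le> \<delta>" "real n * (t / real n) = t"
      using n that \<delta> by (auto simp: field_simps)
    then show ?thesis using \<delta>(2) mult by metis
  qed
  show ?thesis
  proof (cases "t < 0")
    case True
    have g: "F (- t) \<in> G" using pos[of "- t"] True by simp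
    have "F t = F t ** (F (- t) ** matrix_inv (F (- t)))" by (simp add: G_inverse(1)[OF g])
    also have "\<dots> = (F t ** F (- t)) ** matrix_inv (F (- t))"
      by (simp only: matrix_mul_assoc)
    also have "\<dots> = matrix_inv (F (- t))"
      by (simp only: F(1)[symmetric] add.right_inverse F(2) matrix_mul_lid)
    finally show ?thesis using inv_in_G[OF g] by simp
  next
    case False
    then show ?thesis using pos F(2) one_in_G by (cases "t = 0") auto
  qed
qed

end

section \<open>Orthogonal complex structures and unitary bases\<close>

lemma std_form_eq_sum: "std_form P x y = (\<Sum>i\<in>UNIV. (if i \<in> P then 1 else - 1) * (x $ i * y $ i))"
proof -
  have "(\<Sum>i\<in>UNIV. (if i \<in> P then 1 else - 1) * (x $ i * y $ i))
      = (\<Sum>i\<in>P. (if i \<in> P then 1 else - 1) * (x $ i * y $ i))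
      + (\<Sum>i\<in>-P. (if i \<in> P then 1 else - 1) * (x $ i * y $ i))"
    by (subst sum.union_disjoint[symmetric]) (auto simp: Compl_partition)
  also have "\<dots> = std_form P x y"
    by (simp add: std_form_def sum_negf)
  finally show ?thesis by simp
qed

interpretation form: bounded_bilinear "std_form P" for P :: "'n::finite set"
proof -
  have "bilinear (std_form P)"
    by (auto simp: bilinear_def std_form_eq_sum sum.distrib[symmetric] sum_distrib_left algebra_simps
        intro!: linearI sum.cong)
  then show "bounded_bilinear (std_form P)" by (simp add: bilinear_conv_bounded_bilinear)
qed

lemmas form_simps = form.add_left form.add_right form.diff_left form.diff_right form.minus_left
  form.minus_right form.scaleR_left form.scaleR_right form.zero_left form.zero_right

lemma std_form_commute: "std_form P x y = std_form P y x"
  by (simp add: std_form_eq_sum mult.commute)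

lemma std_form_Compl: "std_form (- P) x y = - std_form P x y"
  by (simp add: std_form_def)

lemma std_form_axis: "std_form P x (axis i 1) = (if i \<in> P then x $ i else - x $ i)"
proof -
  have "std_form P x (axis i 1) = (\<Sum>j\<in>UNIV. if j = i then (if i \<in> P then x $ i else - x $ i) else 0)"
    unfolding std_form_eq_sum by (intro sum.cong) (auto simp: axis_def)
  then show ?thesis by simp
qed

lemma std_form_nondegenerate:
  assumes "\<And>y. std_form P x y = 0"
  shows "x = 0"
  unfolding vec_eq_iff
proof
  fix i
  show "x $ i = 0 $ i"
    using assms[of "axis i 1"] by (simp add: std_form_axis split: if_splits)
qed

lemma O_group_iff: "A \<in> O_group P \<longleftrightarrow> (\<forall>x y. std_form P (A *v x) (A *v y) = std_form P x y)"
  by (simp add: O_group_def)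

lemma complex_structure_form:
  assumes "orthogonal_complex_structure P J"
  shows "J *v (J *v x) = - x" and "std_form P (J *v x) (J *v y) = std_form P x y"
    and "std_form P (J *v x) y = - std_form P x (J *v y)" and "std_form P x (J *v x) = 0"
proof -
  show JJ: "J *v (J *v x) = - x" for x
  proof -
    have "J *v (J *v x) = (- mat 1) *v x"
      using assms by (simp add: orthogonal_complex_structure_def matrix_vector_mul_assoc)
    also have "\<dots> = - x"
      using matrix_vector_mult_diff_rdistrib[of 0 "mat 1" x] by simp
    finally show ?thesis .
  qed
  show inv: "std_form P (J *v x) (J *v y) = std_form P x y" for x y
    using assms by (simp add: orthogonal_complex_structure_def O_group_iff)
  show skew: "std_form P (J *v x) y = - std_form P x (J *v y)" for x y
    using inv[of x "J *v y"] by (simp add: JJ form_simps)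
  show "std_form P x (J *v x) = 0"
    using skew[of x x] by (simp add: std_form_commute)
qed

text \<open>
  Orthonormality up to signs for the Hermitian form with real part \<open>std_form P x y\<close> and imaginary
  part \<open>\<plusminus> std_form P x (J y)\<close>. Indexing by \<open>I\<close> makes it possible to compare families for two structures.
\<close>

definition unitary_family :: "'n::finite set \<Rightarrow> real^'n^'n \<Rightarrow> 'i set \<Rightarrow> ('i \<Rightarrow> real^'n) \<Rightarrow> bool" where
  "unitary_family P J I u \<longleftrightarrow>
     (\<forall>i\<in>I. std_form P (u i) (u i) = 1 \<or> std_form P (u i) (u i) = - 1) \<and>
     (\<forall>i\<in>I. \<forall>j\<in>I. i \<noteq> j \<longrightarrow> std_form P (u i) (u j) = 0 \<and> std_form P (u i) (J *v u j) = 0)"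

text \<open>
  A combination with complex coefficients \<open>c i + d i J\<close>. The sign \<open>std_form P (u i) (u i)\<close> is built
  in, so that \<open>c i\<close> and \<open>d i\<close> are recovered as values of the form.
\<close>

definition unitary_sum ::
  "'n::finite set \<Rightarrow> real^'n^'n \<Rightarrow> 'i set \<Rightarrow> ('i \<Rightarrow> real^'n) \<Rightarrow> ('i \<Rightarrow> real) \<Rightarrow> ('i \<Rightarrow> real) \<Rightarrow> real^'n" where
  "unitary_sum P J I u c d =
     (\<Sum>i\<in>I. std_form P (u i) (u i) *\<^sub>R (c i *\<^sub>R u i + d i *\<^sub>R (J *v u i)))"

lemma unitary_sum_coeff:
  assumes J: "orthogonal_complex_structure P J" and u: "unitary_family P J I u"
    and "finite I" "i \<in> I"
  shows "std_form P (u i) (unitary_sum P J I u c d) = c i"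
    and "std_form P (J *v u i) (unitary_sum P J I u c d) = d i"
proof -
  have sq: "std_form P (u i) (u i) * std_form P (u i) (u i) = 1"
    using u \<open>i \<in> I\<close> by (auto simp: unitary_family_def)
  have "std_form P (u i) (unitary_sum P J I u c d)
      = (\<Sum>j\<in>I. if j = i then c i * (std_form P (u i) (u i) * std_form P (u i) (u i)) else 0)"
    unfolding unitary_sum_def form.sum_right
    using u \<open>i \<in> I\<close> complex_structure_form[OF J]
    by (intro sum.cong) (auto simp: form_simps unitary_family_def)
  then show "std_form P (u i) (unitary_sum P J I u c d) = c i"
    using assms sq by simp
  have "std_form P (J *v u i) (unitary_sum P J I u c d)
      = (\<Sum>j\<in>I. if j = i then d i * (std_form P (u i) (u i) * std_form P (u i) (u i)) else 0)"
    unfolding unitary_sum_def form.sum_right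
    using u \<open>i \<in> I\<close> complex_structure_form[OF J]
    by (intro sum.cong) (auto simp: form_simps unitary_family_def)
  then show "std_form P (J *v u i) (unitary_sum P J I u c d) = d i"
    using assms sq by simp
qed

lemma form_unitary_sums:
  assumes J: "orthogonal_complex_structure P J" and u: "unitary_family P J I u" and "finite I"
  shows "std_form P (unitary_sum P J I u a b) (unitary_sum P J I u c d)
    = (\<Sum>i\<in>I. std_form P (u i) (u i) * (a i * c i + b i * d i))"
proof -
  let ?y = "unitary_sum P J I u c d"
  have "std_form P (unitary_sum P J I u a b) ?y
      = (\<Sum>i\<in>I. std_form P (u i) (u i) * (a i * std_form P (u i) ?y + b i * std_form P (J *v u i) ?y))"
    unfolding unitary_sum_def[of P J I u a b] form.sum_left
    by (simp add: form_simps)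
  also have "\<dots> = (\<Sum>i\<in>I. std_form P (u i) (u i) * (a i * c i + b i * d i))"
    using unitary_sum_coeff[OF J u \<open>finite I\<close>] by (intro sum.cong) auto
  finally show ?thesis .
qed

lemma independent_form_orthogonal:
  assumes "\<And>a b. a \<in> T \<Longrightarrow> b \<in> T \<Longrightarrow> a \<noteq> b \<Longrightarrow> std_form P a b = 0"
    and "\<And>a. a \<in> T \<Longrightarrow> std_form P a a \<noteq> 0"
  shows "independent T"
proof
  assume "dependent T"
  then obtain t u v where t: "finite t" "t \<subseteq> T" "(\<Sum>v\<in>t. u v *\<^sub>R v) = 0" "v \<in> t" "u v \<noteq> 0"
    unfolding dependent_explicit by blast
  have "0 = std_form P v (\<Sum>w\<in>t. u w *\<^sub>R w)" by (simp add: t(3) form_simps)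
  also have "\<dots> = (\<Sum>w\<in>t. if w = v then u v * std_form P v v else 0)"
    unfolding form.sum_right using assms(1) t by (intro sum.cong) (auto simp: form_simps subset_iff)
  also have "\<dots> = u v * std_form P v v" using t by simp
  finally show False using assms(2) t by auto
qed

lemma unitary_set_independent:
  assumes J: "orthogonal_complex_structure P J" and S: "unitary_family P J S (\<lambda>e. e)"
  shows "independent (S \<union> (*v) J ` S)" and "finite S" and "card (S \<union> (*v) J ` S) = 2 * card S"
proof -
  note f = complex_structure_form[OF J]
  have nz: "std_form P e e \<noteq> 0" if "e \<in> S" for e
    using S that by (auto simp: unitary_family_def)
  have SJ: "std_form P e (J *v g) = 0" if "e \<in> S" "g \<in> S" for e g
    using S that f(4) by (cases "e = g") (auto simp: unitary_family_def)
  have SS: "std_form P e g = 0" if "e \<in> S" "g \<in> S" "e \<noteq> g" for e g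
    using S that by (auto simp: unitary_family_def)
  have JS: "std_form P (J *v g) e = 0" if "e \<in> S" "g \<in> S" for e g
    using SJ[OF that] by (simp add: std_form_commute[of P "J *v g"])
  show ind: "independent (S \<union> (*v) J ` S)"
  proof (rule independent_form_orthogonal[where P = P])
    fix a b assume "a \<in> S \<union> (*v) J ` S" "b \<in> S \<union> (*v) J ` S" "a \<noteq> b"
    then show "std_form P a b = 0"
      using SJ JS f(2) by (auto intro: SS)
  next
    fix a assume "a \<in> S \<union> (*v) J ` S"
    then show "std_form P a a \<noteq> 0" using nz f(2) by auto
  qed
  then have "finite (S \<union> (*v) J ` S)" by (rule independent_imp_finite)
  then show fin: "finite S" by simp
  have "S \<inter> (*v) J ` S = {}"
  proof (rule equals0I)
    fix a assume "a \<in> S \<inter> (*v) J ` S"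
    then obtain g where "a \<in> S" "g \<in> S" "a = J *v g" by blast
    then show False using nz SJ by metis
  qed
  moreover have "inj_on ((*v) J) S"
    by (rule inj_onI) (metis f(1) neg_equal_iff_equal)
  ultimately show "card (S \<union> (*v) J ` S) = 2 * card S"
    using fin by (simp add: card_Un_disjoint card_image)
qed

text \<open>
  Take a unitary set \<open>S\<close> of maximal size and let \<open>V\<close> be the orthogonal complement of \<open>S\<close> and \<open>J S\<close>. A
  vector of \<open>V\<close> with nonzero square could be normalized and added to \<open>S\<close>, so the form vanishes on
  \<open>V\<close>. Then \<open>V\<close> is orthogonal to the whole space and nondegeneracy gives \<open>V = 0\<close>.
\<close>

lemma unitary_basis_exists:
  fixes P :: "'n::finite set"
  assumes J: "orthogonal_complex_structure P J"
  shows "\<exists>S. finite S \<and> unitary_family P J S (\<lambda>e. e) \<and>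
    (\<forall>x. x = unitary_sum P J S (\<lambda>e. e) (\<lambda>e. std_form P x e) (\<lambda>e. std_form P x (J *v e)))"
proof -
  note f = complex_structure_form[OF J]
  let ?U = "\<lambda>S. unitary_family P J S (\<lambda>e. e)"
  have "?U {}" by (simp add: unitary_family_def)
  moreover have "card S < CARD('n) + 1" if "?U S" for S
  proof -
    have "2 * card S \<le> CARD('n)"
      using independent_card_le[OF unitary_set_independent(1)[OF J that]]
        unitary_set_independent(3)[OF J that] by simp
    then show ?thesis by simp
  qed
  ultimately obtain S where S: "?U S" and max: "\<And>S'. ?U S' \<Longrightarrow> card S' \<le> card S"
    using ex_has_greatest_nat[of ?U "{}" card "CARD('n) + 1"] by blast
  have fin: "finite S" by (rule unitary_set_independent(2)[OF J S])
  define pr where "pr x = unitary_sum P J S (\<lambda>e. e) (\<lambda>e. std_form P x e) (\<lambda>e. std_form P x (J *v e))" for x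
  define V where "V = {v. \<forall>e\<in>S. std_form P v e = 0 \<and> std_form P v (J *v e) = 0}"
  have prV: "x - pr x \<in> V" for x
  proof -
    have "std_form P (pr x) e = std_form P x e" "std_form P (pr x) (J *v e) = std_form P x (J *v e)"
      if "e \<in> S" for e
      using unitary_sum_coeff[OF J S fin that]
      by (simp_all add: pr_def std_form_commute[of P "unitary_sum P J S (\<lambda>e. e) _ _"])
    then show ?thesis by (simp add: V_def form.diff_left)
  qed
  have Vpr: "std_form P v (pr x) = 0" if "v \<in> V" for v x
    using that unfolding pr_def unitary_sum_def form.sum_right
    by (intro sum.neutral) (auto simp: V_def form_simps)
  have null: "std_form P w w = 0" if w: "w \<in> V" for w
  proof (rule ccontr)
    assume ne: "std_form P w w \<noteq> 0"
    define e where "e = (1 / sqrt \<bar>std_form P w w\<bar>) *\<^sub>R w"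
    have "std_form P e e = std_form P w w / \<bar>std_form P w w\<bar>"
      by (simp add: e_def form.scaleR_left form.scaleR_right)
    then have ee: "std_form P e e = 1 \<or> std_form P e e = - 1"
      using ne by (auto simp: abs_if)
    have eV: "std_form P e g = 0" "std_form P e (J *v g) = 0" if "g \<in> S" for g
      using w that by (auto simp: V_def e_def form_simps)
    then have "e \<notin> S" using ee by fastforce
    have "std_form P g e = 0" "std_form P g (J *v e) = 0" if "g \<in> S" for g
      using eV[OF that] f(3)[of g e] by (simp_all add: std_form_commute[of P g e] std_form_commute[of P e "J *v g"])
    with eV ee S have "?U (insert e S)"
      unfolding unitary_family_def by simp
    from max[OF this] show False using \<open>e \<notin> S\<close> fin by simp
  qed
  have V0: "v = 0" if v: "v \<in> V" for v
  proof (rule std_form_nondegenerate)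
    fix y
    \<comment> \<open>Polarization: the form vanishes on \<open>V\<close> because its squares do.\<close>
    have sumV: "v + (y - pr y) \<in> V" using v prV[of y] by (auto simp: V_def form_simps)
    have "0 = std_form P (v + (y - pr y)) (v + (y - pr y))" using null[OF sumV] by simp
    also have "\<dots> = std_form P v v + 2 * std_form P v (y - pr y) + std_form P (y - pr y) (y - pr y)"
      using std_form_commute[of P v "y - pr y"] by (simp only: form.add_left form.add_right)
    finally have "std_form P v (y - pr y) = 0" using null[OF v] null[OF prV] by simp
    then show "std_form P v y = 0" using Vpr[OF v] by (simp add: form.diff_right)
  qed
  have "x = pr x" for x using V0[OF prV[of x]] by simp
  then show ?thesis using fin S unfolding pr_def by blast
qed

text \<open>
  One half of Sylvester's law of inertia. The form is positive definite on the span of the positive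
  pairs \<open>e\<close>, \<open>J e\<close>, but not positive on vectors whose coordinates in \<open>P\<close> vanish; so the projection to the
  coordinates in \<open>P\<close> is injective on this span.
\<close>

lemma positive_unitary_count:
  fixes P :: "'n::finite set"
  assumes J: "orthogonal_complex_structure P J" and S: "unitary_family P J S (\<lambda>e. e)"
    and exp: "\<And>x. x = unitary_sum P J S (\<lambda>e. e) (\<lambda>e. std_form P x e) (\<lambda>e. std_form P x (J *v e))"
  shows "2 * card {e \<in> S. std_form P e e = 1} \<le> card P"
proof -
  let ?S = "{e \<in> S. std_form P e e = 1}"
  let ?T = "?S \<union> (*v) J ` ?S"
  note f = complex_structure_form[OF J]
  have fin: "finite S" by (rule unitary_set_independent(2)[OF J S])
  have S': "unitary_family P J ?S (\<lambda>e. e)" using S by (auto simp: unitary_family_def)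
  have zero: "x = 0" if x: "x \<in> span ?T" and P0: "\<And>i. i \<in> P \<Longrightarrow> x $ i = 0" for x
  proof -
    let ?a = "\<lambda>e. std_form P x e" and ?b = "\<lambda>e. std_form P x (J *v e)"
    have neg: "?a e = 0 \<and> ?b e = 0" if e: "e \<in> S - ?S" for e
      using x
    proof (induction rule: span_induct_alt)
      case base
      show ?case by (simp add: form_simps)
    next
      case (step c y z)
      then obtain g where g: "g \<in> ?S" "y = g \<or> y = J *v g" by blast
      then have "g \<in> S" "g \<noteq> e" using e by auto
      then have "std_form P g e = 0" "std_form P g (J *v e) = 0"
        using S e unfolding unitary_family_def by blast+
      then have "std_form P y e = 0 \<and> std_form P y (J *v e) = 0"
        using g(2) f(2,3) by auto
      with step show ?case by (simp add: form_simps)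
    qed
    have "std_form P x x = (\<Sum>e\<in>S. std_form P e e * (?a e * ?a e + ?b e * ?b e))"
      by (subst (1 2) exp) (rule form_unitary_sums[OF J S fin])
    also have "\<dots> = (\<Sum>e\<in>S. (?a e)\<^sup>2 + (?b e)\<^sup>2)"
      using neg by (intro sum.cong) (auto simp: power2_eq_square)
    finally have eq: "std_form P x x = (\<Sum>e\<in>S. (?a e)\<^sup>2 + (?b e)\<^sup>2)" .
    have "std_form P x x = - (\<Sum>i\<in>-P. x $ i * x $ i)"
      using P0 by (simp add: std_form_def)
    also have "\<dots> \<le> 0" by (simp add: sum_nonneg)
    finally have "(\<Sum>e\<in>S. (?a e)\<^sup>2 + (?b e)\<^sup>2) = 0"
      using eq by (smt (verit) sum_nonneg zero_le_power2)
    then have "?a e = 0 \<and> ?b e = 0" if "e \<in> S" for e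
      using that fin by (subst (asm) sum_nonneg_eq_0_iff) (auto simp: sum_power2_eq_zero_iff)
    then show "x = 0" by (subst exp) (simp add: unitary_sum_def)
  qed
  define g :: "real^'n \<Rightarrow> real^'n" where "g x = (\<chi> i. if i \<in> P then x $ i else 0)" for x
  have lin: "linear g" by (rule linearI) (auto simp: g_def vec_eq_iff)
  have "inj_on g (span ?T)"
    unfolding linear_injective_on_subspace_0[OF lin subspace_span]
    using zero by (auto simp: g_def vec_eq_iff)
  then have "dim (g ` ?T) = dim ?T" by (rule dim_image_eq[OF lin])
  also have "\<dots> = 2 * card ?S"
    by (simp only: dim_eq_card_independent[OF unitary_set_independent(1)[OF J S']]
        unitary_set_independent(3)[OF J S'])
  finally have "2 * card ?S = dim (g ` ?T)" by simp
  also have "\<dots> \<le> dim {x :: real^'n. \<forall>i. i \<notin> P \<longrightarrow> x $ i = 0}"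
    by (rule dim_subset) (auto simp: g_def)
  also have "\<dots> = card P" by (simp only: dim_substandard_cart dim_vec_eq[symmetric])
  finally show ?thesis .
qed

text \<open>
  The inequality just proved holds for the form and its negative, that is for \<open>P\<close> and \<open>- P\<close>. The
  unitary basis spans the space, so the two inequalities add up to an equality.
\<close>

lemma unitary_basis_signature:
  fixes P :: "'n::finite set"
  assumes J: "orthogonal_complex_structure P J" and S: "unitary_family P J S (\<lambda>e. e)"
    and exp: "\<And>x. x = unitary_sum P J S (\<lambda>e. e) (\<lambda>e. std_form P x e) (\<lambda>e. std_form P x (J *v e))"
  shows "2 * card {e \<in> S. std_form P e e = 1} = card P"
    and "2 * card {e \<in> S. std_form P e e = - 1} = card (- P)"
proof -
  let ?Sp = "{e \<in> S. std_form P e e = 1}" and ?Sm = "{e \<in> S. std_form P e e = - 1}"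
  have fin: "finite S" by (rule unitary_set_independent(2)[OF J S])
  have p: "2 * card ?Sp \<le> card P" by (rule positive_unitary_count[OF J S exp])
  have "2 * card {e \<in> S. std_form (- P) e e = 1} \<le> card (- P)"
  proof (rule positive_unitary_count)
    show "orthogonal_complex_structure (- P) J"
      using J by (simp add: orthogonal_complex_structure_def O_group_iff std_form_Compl)
    show "unitary_family (- P) J S (\<lambda>e. e)"
      using S by (auto simp: unitary_family_def std_form_Compl)
    show "x = unitary_sum (- P) J S (\<lambda>e. e) (\<lambda>e. std_form (- P) x e) (\<lambda>e. std_form (- P) x (J *v e))" for x
      using exp[of x] by (simp add: unitary_sum_def std_form_Compl algebra_simps)
  qed
  moreover have "{e \<in> S. std_form (- P) e e = 1} = ?Sm" by (auto simp: std_form_Compl)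
  ultimately have m: "2 * card ?Sm \<le> card (- P)" by simp
  have "S = ?Sp \<union> ?Sm" using S by (auto simp: unitary_family_def)
  then have "card S = card ?Sp + card ?Sm"
    using fin card_Un_disjoint[of ?Sp ?Sm] by force
  moreover have "UNIV \<subseteq> span (S \<union> (*v) J ` S)"
  proof
    fix x
    show "x \<in> span (S \<union> (*v) J ` S)"
      by (subst exp[of x], unfold unitary_sum_def)
        (intro span_sum span_scale span_add span_base; blast)
  qed
  then have "dim (UNIV :: (real^'n) set) \<le> card (S \<union> (*v) J ` S)"
    using fin by (intro dim_le_card) auto
  then have "CARD('n) \<le> 2 * card S"
    using unitary_set_independent(3)[OF J S] by simp
  moreover have "CARD('n) = card P + card (- P)"
    by (metis card_Un_disjoint Compl_disjoint Compl_partition finite)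
  ultimately show "2 * card ?Sp = card P" "2 * card ?Sm = card (- P)"
    using p m by linarith+
qed

lemma signature_even:
  assumes J: "orthogonal_complex_structure P J"
  shows "even (card P)" and "even (card (- P))"
proof -
  obtain S where S: "unitary_family P J S (\<lambda>e. e)"
    and exp: "\<forall>x. x = unitary_sum P J S (\<lambda>e. e) (\<lambda>e. std_form P x e) (\<lambda>e. std_form P x (J *v e))"
    using unitary_basis_exists[OF J] by (elim exE conjE)
  note sig = unitary_basis_signature[OF J S exp[rule_format]]
  show "even (card P)" by (rule dvdI[OF sig(1)[symmetric]])
  show "even (card (- P))" by (rule dvdI[OF sig(2)[symmetric]])
qed

text \<open>
  Unitary bases for \<open>J\<close> and \<open>J'\<close> have equally many elements of each sign. A sign-preserving bijection
  between them extends to a map that is complex linear from \<open>J\<close> to \<open>J'\<close> and an isometry.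
\<close>

lemma complex_structures_conjugate:
  fixes P :: "'n::finite set"
  assumes J: "orthogonal_complex_structure P J" and J': "orthogonal_complex_structure P J'"
  shows "\<exists>h \<in> O_group P. h ** J = J' ** h"
proof -
  obtain S where S: "unitary_family P J S (\<lambda>e. e)"
    and exp: "\<forall>x. x = unitary_sum P J S (\<lambda>e. e) (\<lambda>e. std_form P x e) (\<lambda>e. std_form P x (J *v e))"
    using unitary_basis_exists[OF J] by (elim exE conjE)
  obtain S' where S': "unitary_family P J' S' (\<lambda>e. e)"
    and exp': "\<forall>x. x = unitary_sum P J' S' (\<lambda>e. e) (\<lambda>e. std_form P x e) (\<lambda>e. std_form P x (J' *v e))"
    using unitary_basis_exists[OF J'] by (elim exE conjE)
  have fin: "finite S" "finite S'"
    using unitary_set_independent(2) J J' S S' by blast+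
  let ?p = "\<lambda>S. {e \<in> S. std_form P e e = 1}" and ?m = "\<lambda>S. {e \<in> S. std_form P e e = - 1}"
  have card: "card (?p S) = card (?p S')" "card (?m S) = card (?m S')"
    using unitary_basis_signature[OF J S exp[rule_format]]
      unitary_basis_signature[OF J' S' exp'[rule_format]] by linarith+
  obtain \<sigma>p where bijp: "bij_betw \<sigma>p (?p S) (?p S')"
    using finite_same_card_bij[OF _ _ card(1)] fin by auto
  obtain \<sigma>m where bijm: "bij_betw \<sigma>m (?m S) (?m S')"
    using finite_same_card_bij[OF _ _ card(2)] fin by auto
  define \<sigma> where "\<sigma> e = (if std_form P e e = 1 then \<sigma>p e else \<sigma>m e)" for e
  have \<sigma>p: "\<sigma> e \<in> S'" "std_form P (\<sigma> e) (\<sigma> e) = 1" if "e \<in> S" "std_form P e e = 1" for e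
    using bij_betwE[OF bijp] that by (auto simp: \<sigma>_def)
  have \<sigma>m: "\<sigma> e \<in> S'" "std_form P (\<sigma> e) (\<sigma> e) = - 1" if "e \<in> S" "std_form P e e = - 1" for e
    using bij_betwE[OF bijm] that by (auto simp: \<sigma>_def)
  have sgn: "std_form P e e = 1 \<or> std_form P e e = - 1" if "e \<in> S" for e
    using S that by (auto simp: unitary_family_def)
  have \<sigma>S': "\<sigma> e \<in> S'" and \<sigma>_form: "std_form P (\<sigma> e) (\<sigma> e) = std_form P e e" if "e \<in> S" for e
    using sgn[OF that] \<sigma>p[OF that] \<sigma>m[OF that] by auto
  have \<sigma>_inj: "\<sigma> e \<noteq> \<sigma> g" if "e \<in> S" "g \<in> S" "e \<noteq> g" for e g
  proof
    assume eq: "\<sigma> e = \<sigma> g"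
    then have same: "std_form P e e = std_form P g g" using \<sigma>_form that by metis
    show False
    proof (cases "std_form P e e = 1")
      case True
      then show False
        using same eq that bijp by (auto simp: \<sigma>_def bij_betw_def inj_on_def)
    next
      case False
      then have "std_form P e e = - 1" "std_form P g g = - 1"
        using sgn[OF that(1)] same by auto
      then show False
        using eq that bijm by (auto simp: \<sigma>_def bij_betw_def inj_on_def)
    qed
  qed
  have \<sigma>: "unitary_family P J' S \<sigma>"
    using S' sgn \<sigma>S' \<sigma>_form \<sigma>_inj unfolding unitary_family_def by metis
  define k where "k x = unitary_sum P J' S \<sigma> (\<lambda>e. std_form P x e) (\<lambda>e. std_form P x (J *v e))" for x
  have "linear k"
    by (rule linearI)
      (simp_all add: k_def unitary_sum_def form_simps sum.distrib[symmetric] scaleR_sum_right algebra_simps)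
  define h where "h = matrix k"
  have h: "h *v x = k x" for x using \<open>linear k\<close> by (simp add: h_def matrix_works)
  have "std_form P (k x) (k y) = std_form P x y" for x y
  proof -
    have "std_form P (k x) (k y) = (\<Sum>e\<in>S. std_form P e e *
        (std_form P x e * std_form P y e + std_form P x (J *v e) * std_form P y (J *v e)))"
      unfolding k_def form_unitary_sums[OF J' \<sigma> fin(1)] using \<sigma>_form by (intro sum.cong) auto
    also have "\<dots> = std_form P
      (unitary_sum P J S (\<lambda>e. e) (\<lambda>e. std_form P x e) (\<lambda>e. std_form P x (J *v e)))
      (unitary_sum P J S (\<lambda>e. e) (\<lambda>e. std_form P y e) (\<lambda>e. std_form P y (J *v e)))"
      by (rule form_unitary_sums[OF J S fin(1), symmetric])
    also have "\<dots> = std_form P x y"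
      by (simp only: exp[rule_format, symmetric])
    finally show ?thesis .
  qed
  then have "h \<in> O_group P" by (simp add: O_group_iff h)
  moreover have "h ** J = J' ** h"
  proof -
    have "k (J *v x) = J' *v k x" for x
    proof -
      have "J' *v k x = (\<Sum>e\<in>S. J' *v (std_form P (\<sigma> e) (\<sigma> e) *\<^sub>R
          (std_form P x e *\<^sub>R \<sigma> e + std_form P x (J *v e) *\<^sub>R (J' *v \<sigma> e))))"
        unfolding k_def unitary_sum_def
        by (rule linear_sum[OF matrix_vector_mul_linear])
      also have "\<dots> = k (J *v x)"
        unfolding k_def unitary_sum_def
        by (intro sum.cong) (auto simp: matrix_vector_mult_scaleR matrix_vector_right_distrib
            complex_structure_form(2,3)[OF J] complex_structure_form(1)[OF J] complex_structure_form(1)[OF J'] form.minus_right algebra_simps)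
      finally show ?thesis by simp
    qed
    then show ?thesis by (simp add: matrix_eq matrix_vector_mul_assoc[symmetric] h)
  qed
  ultimately show ?thesis by blast
qed

section \<open>Central elements and the circle group\<close>

lemma bounded_linear_matrix_apply: "bounded_linear (\<lambda>A :: real^'n::finite^'n. A *v x)"
proof -
  have "linear (\<lambda>A :: real^'n^'n. A *v x)"
    by (rule linearI) (simp_all add: matrix_vector_mult_add_rdistrib scaleR_matrix_vector_assoc)
  then show ?thesis by (simp add: linear_conv_bounded_linear)
qed

text \<open>
  Differentiate the invariance of the form along a curve through the identity.
\<close>

lemma lie_algebra_skew:
  assumes "lie_subgroup M G (O_group P)" and X: "X \<in> lie_algebra_of M"
  shows "std_form P (X *v x) y = - std_form P x (X *v y)"
proof -
  interpret immersed_lie_subgroup M G "O_group P" by unfold_locales fact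
  obtain \<gamma> \<delta> where \<gamma>: "\<delta> > 0" "\<forall>t. \<bar>t\<bar> < \<delta> \<longrightarrow> \<gamma> t \<in> G" "\<gamma> 0 = mat 1"
    "(\<gamma> has_vector_derivative X) (at 0)"
    using lie_algebra_curve[OF X] by (elim exE conjE)
  define b where "b t = std_form P (\<gamma> t *v x) (\<gamma> t *v y)" for t
  have "((\<lambda>t. \<gamma> t *v x) has_vector_derivative X *v x) (at 0)" for x
    by (rule bounded_linear.has_vector_derivative[OF bounded_linear_matrix_apply \<gamma>(4)])
  from form.has_vector_derivative[OF this this]
  have "(b has_vector_derivative std_form P (\<gamma> 0 *v x) (X *v y) + std_form P (X *v x) (\<gamma> 0 *v y)) (at 0)"
    by (simp only: b_def[abs_def])
  then have b': "(b has_vector_derivative std_form P x (X *v y) + std_form P (X *v x) y) (at 0)"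
    by (simp only: \<gamma>(3) matrix_vector_mul_lid)
  have "b t = std_form P x y" if "t \<in> ball 0 \<delta>" for t
    using G_in_H[OF \<gamma>(2)[rule_format, of t]] that by (simp add: b_def O_group_iff)
  then have "(b has_vector_derivative 0) (at 0)"
    using has_vector_derivative_transform_within_open[of "\<lambda>t. std_form P x y" 0 0 "ball 0 \<delta>" b] \<gamma>(1)
    by simp
  from vector_derivative_unique_at[OF b' this] show ?thesis by simp
qed

text \<open>
  Schur's lemma: the kernel of \<open>a\<close> is invariant under \<open>G\<close>.
\<close>

lemma irreducible_singular_zero:
  assumes irr: "acts_irreducibly G" and comm: "\<And>g. g \<in> G \<Longrightarrow> a ** g = g ** a"
    and "v \<noteq> 0" "a *v v = 0"
  shows "a = (0 :: real^'n::finite^'n)"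
proof -
  let ?K = "{v. a *v v = 0}"
  have "subspace ?K"
    by (auto simp: subspace_def matrix_vector_right_distrib matrix_vector_mult_scaleR)
  moreover have "g *v w \<in> ?K" if "g \<in> G" "w \<in> ?K" for g w
  proof -
    have "a *v (g *v w) = g *v (a *v w)"
      using comm[OF \<open>g \<in> G\<close>] by (simp add: matrix_vector_mul_assoc)
    then show ?thesis using that by simp
  qed
  ultimately have "?K = {0} \<or> ?K = UNIV"
    using irr unfolding acts_irreducibly_def by blast
  then have "a *v w = 0" for w using assms(3,4) by blast
  then show ?thesis by (simp add: matrix_eq)
qed

lemma irreducible_commutant_quadratic:
  fixes a :: "real^'n::finite^'n"
  assumes irr: "acts_irreducibly G" and comm: "\<And>g. g \<in> G \<Longrightarrow> a ** g = g ** a"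
  shows "\<exists>\<alpha> \<beta>. (a - \<alpha> *\<^sub>R mat 1) ** (a - \<alpha> *\<^sub>R mat 1) = - (\<beta>\<^sup>2 *\<^sub>R mat 1)"
proof -
  obtain \<alpha> \<beta> v where v: "v \<noteq> 0"
    "((a - \<alpha> *\<^sub>R mat 1) ** (a - \<alpha> *\<^sub>R mat 1) + \<beta>\<^sup>2 *\<^sub>R mat 1) *v v = 0"
    using exists_singular_quadratic[of a] by blast
  have "(a - \<alpha> *\<^sub>R mat 1) ** (a - \<alpha> *\<^sub>R mat 1) + \<beta>\<^sup>2 *\<^sub>R mat 1 = 0"
  proof (rule irreducible_singular_zero[OF irr _ v])
    fix g assume "g \<in> G"
    then have c: "(a - \<alpha> *\<^sub>R mat 1) ** g = g ** (a - \<alpha> *\<^sub>R mat 1)"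
      using comm by (simp add: matmul_distribs)
    have "(a - \<alpha> *\<^sub>R mat 1) ** (a - \<alpha> *\<^sub>R mat 1) ** g = g ** ((a - \<alpha> *\<^sub>R mat 1) ** (a - \<alpha> *\<^sub>R mat 1))"
      by (metis c matrix_mul_assoc)
    then show "((a - \<alpha> *\<^sub>R mat 1) ** (a - \<alpha> *\<^sub>R mat 1) + \<beta>\<^sup>2 *\<^sub>R mat 1) ** g
        = g ** ((a - \<alpha> *\<^sub>R mat 1) ** (a - \<alpha> *\<^sub>R mat 1) + \<beta>\<^sup>2 *\<^sub>R mat 1)"
      by (simp only: matmul.add_left matmul.add_right matmul.scaleR_left matmul.scaleR_right
          matrix_mul_lid matrix_mul_rid)
  qed
  then show ?thesis by (metis eq_neg_iff_add_eq_0)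
qed

text \<open>
  Taking adjoints with respect to the form replaces \<open>Z\<close> by \<open>- Z\<close>, which changes the sign of the linear
  term in the quadratic equation of \<open>Z\<close>. Hence this term vanishes and \<open>Z\<^sup>2 = - \<beta>\<^sup>2\<close>.
\<close>

lemma skew_commutant_complex_structure:
  fixes Z :: "real^'n::finite^'n"
  assumes irr: "acts_irreducibly G" and comm: "\<And>g. g \<in> G \<Longrightarrow> Z ** g = g ** Z"
    and skew: "\<And>x y. std_form P (Z *v x) y = - std_form P x (Z *v y)" and "Z \<noteq> 0"
  shows "\<exists>\<beta> J. \<beta> \<noteq> 0 \<and> Z = \<beta> *\<^sub>R J \<and> orthogonal_complex_structure P J"
proof -
  obtain \<alpha> \<beta> where q: "(Z - \<alpha> *\<^sub>R mat 1) ** (Z - \<alpha> *\<^sub>R mat 1) = - (\<beta>\<^sup>2 *\<^sub>R mat 1)"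
    using irreducible_commutant_quadratic[OF irr comm] by blast
  have "Z ** Z = (Z - \<alpha> *\<^sub>R mat 1) ** (Z - \<alpha> *\<^sub>R mat 1) + \<alpha> *\<^sub>R Z + \<alpha> *\<^sub>R Z - (\<alpha> * \<alpha>) *\<^sub>R mat 1"
    by (simp add: matmul_distribs scaleR_diff_right)
  then have ZZ: "Z ** Z = (2 * \<alpha>) *\<^sub>R Z - (\<alpha>\<^sup>2 + \<beta>\<^sup>2) *\<^sub>R mat 1"
    by (simp only: q power2_eq_square mult_2 scaleR_add_left) (simp only: diff_conv_add_uminus minus_add_distrib add_ac)
  have Zx: "Z *v (Z *v x) = (2 * \<alpha>) *\<^sub>R (Z *v x) - (\<alpha>\<^sup>2 + \<beta>\<^sup>2) *\<^sub>R x" for x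
    unfolding matrix_vector_mul_assoc ZZ
    by (simp only: matrix_vector_mult_diff_rdistrib scaleR_matrix_vector_assoc[symmetric] matrix_vector_mul_lid)
  have "\<alpha> *\<^sub>R (Z *v x) = 0" for x
  proof (rule std_form_nondegenerate)
    fix y
    have "std_form P (Z *v (Z *v x)) y = std_form P x (Z *v (Z *v y))"
      by (simp add: skew form_simps)
    then have "2 * \<alpha> * std_form P (Z *v x) y = 2 * \<alpha> * std_form P x (Z *v y)"
      by (simp add: Zx form_simps)
    then show "std_form P (\<alpha> *\<^sub>R (Z *v x)) y = 0"
      using skew[of x y] by (simp add: form_simps)
  qed
  moreover obtain w where w: "Z *v w \<noteq> 0"
    using \<open>Z \<noteq> 0\<close> by (metis matrix_eq matrix_vector_mult_0)
  ultimately have "\<alpha> = 0" by (metis scaleR_eq_0_iff)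
  then have Zx: "Z *v (Z *v x) = - (\<beta>\<^sup>2 *\<^sub>R x)" for x using Zx by simp
  have "\<beta> \<noteq> 0"
  proof
    assume "\<beta> = 0"
    then have "Z *v (Z *v w) = 0" using Zx by simp
    with irreducible_singular_zero[OF irr comm w] \<open>Z \<noteq> 0\<close> show False by blast
  qed
  define J where "J = (1 / \<beta>) *\<^sub>R Z"
  have Jx: "J *v x = (1 / \<beta>) *\<^sub>R (Z *v x)" for x
    by (simp add: J_def scaleR_matrix_vector_assoc)
  have JJ: "J *v (J *v x) = - x" for x
    using \<open>\<beta> \<noteq> 0\<close> by (simp add: Jx matrix_vector_mult_scaleR Zx power2_eq_square)
  have "J ** J = - mat 1"
    unfolding matrix_eq
  proof
    fix x
    show "(J ** J) *v x = (- mat 1) *v x"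
      using JJ[of x] matrix_vector_mult_diff_rdistrib[of 0 "mat 1" x]
      by (simp add: matrix_vector_mul_assoc)
  qed
  moreover have "std_form P (J *v x) (J *v y) = std_form P x y" for x y
  proof -
    have "std_form P (J *v x) (J *v y) = - std_form P x (J *v (J *v y))"
      by (simp add: Jx skew form_simps matrix_vector_mult_scaleR)
    then show ?thesis by (simp add: JJ form_simps)
  qed
  ultimately have "orthogonal_complex_structure P J"
    by (simp add: orthogonal_complex_structure_def O_group_iff)
  moreover have "Z = \<beta> *\<^sub>R J" using \<open>\<beta> \<noteq> 0\<close> by (simp add: J_def)
  ultimately show ?thesis using \<open>\<beta> \<noteq> 0\<close> by blast
qed

text \<open>
  The exponential of \<open>t J\<close>, for \<open>J\<^sup>2 = - 1\<close>.
\<close>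

definition rotation :: "real^'n::finite^'n \<Rightarrow> real \<Rightarrow> real^'n^'n" where
  "rotation J t = cos t *\<^sub>R mat 1 + sin t *\<^sub>R J"

lemma U1_group_rotation: "U1_group J = range (rotation J)"
  by (auto simp: U1_group_def rotation_def)

lemma rotation_add:
  assumes "J ** J = - mat 1"
  shows "rotation J (s + t) = rotation J s ** rotation J t"
  by (simp add: rotation_def matmul_distribs assms cos_add sin_add algebra_simps)

lemma rotation_derivative:
  "((\<lambda>t. rotation J (c * t)) has_vector_derivative c *\<^sub>R J) (at 0)"
  unfolding rotation_def has_vector_derivative_def
  by (auto intro!: derivative_eq_intros)

text \<open>
  A central \<open>z\<close> satisfies \<open>(z - \<alpha>)\<^sup>2 = - \<beta>\<^sup>2 = (\<beta> J)\<^sup>2\<close>. It commutes with \<open>J\<close>, so the difference of the two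
  squares factors, and by Schur's lemma one factor is 0.
\<close>

lemma center_eq_U1_group:
  fixes J :: "real^'n::finite^'n"
  assumes irr: "acts_irreducibly G" and GO: "G \<subseteq> O_group P"
    and J: "orthogonal_complex_structure P J"
    and comm: "\<And>g. g \<in> G \<Longrightarrow> J ** g = g ** J" and U1: "\<And>t. rotation J t \<in> G"
  shows "center G = U1_group J"
proof
  show "U1_group J \<subseteq> center G"
    using U1 comm by (auto simp: U1_group_rotation center_def) (simp add: rotation_def matmul_distribs)
next
  show "center G \<subseteq> U1_group J"
  proof
    fix z assume "z \<in> center G"
    then have z: "z \<in> G" "\<And>g. g \<in> G \<Longrightarrow> z ** g = g ** z" by (auto simp: center_def)
    \<comment> \<open>The rotation by a right angle is \<open>J\<close> itself, so \<open>J\<close> belongs to \<open>G\<close>.\<close>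
    have zJ: "z ** J = J ** z" using z(2)[OF U1[of "pi / 2"]] by (simp add: rotation_def)
    have JJ: "J ** J = - mat 1" using J by (simp add: orthogonal_complex_structure_def)
    obtain \<alpha> \<beta> where q: "(z - \<alpha> *\<^sub>R mat 1) ** (z - \<alpha> *\<^sub>R mat 1) = - (\<beta>\<^sup>2 *\<^sub>R mat 1)"
      using irreducible_commutant_quadratic[OF irr z(2)] by blast
    let ?y = "z - \<alpha> *\<^sub>R mat 1"
    have yJ: "?y ** J = J ** ?y" using zJ by (simp add: matmul_distribs)
    have "(?y - \<beta> *\<^sub>R J) ** (?y + \<beta> *\<^sub>R J) = ?y ** ?y + \<beta> *\<^sub>R (?y ** J - J ** ?y) - (\<beta> * \<beta>) *\<^sub>R (J ** J)"
      by (simp only: matmul.add_right matmul.diff_left matmul.scaleR_left matmul.scaleR_right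
          scaleR_diff_right scaleR_scaleR) (simp add: algebra_simps)
    then have factor: "(?y - \<beta> *\<^sub>R J) ** (?y + \<beta> *\<^sub>R J) = 0"
      by (simp add: q yJ JJ power2_eq_square)
    have "\<exists>\<beta>. z = \<alpha> *\<^sub>R mat 1 + \<beta> *\<^sub>R J"
    proof (cases "?y + \<beta> *\<^sub>R J = 0")
      case True
      then have "z = \<alpha> *\<^sub>R mat 1 + (- \<beta>) *\<^sub>R J" by (simp add: algebra_simps eq_neg_iff_add_eq_0)
      then show ?thesis by blast
    next
      case False
      then obtain v where v: "(?y + \<beta> *\<^sub>R J) *v v \<noteq> 0"
        by (metis matrix_eq matrix_vector_mult_0)
      have "?y - \<beta> *\<^sub>R J = 0"
      proof (rule irreducible_singular_zero[OF irr _ v])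
        show "(?y - \<beta> *\<^sub>R J) *v ((?y + \<beta> *\<^sub>R J) *v v) = 0"
          by (simp only: matrix_vector_mul_assoc factor) simp
        show "(?y - \<beta> *\<^sub>R J) ** g = g ** (?y - \<beta> *\<^sub>R J)" if "g \<in> G" for g
          using z(2)[OF that] comm[OF that] by (simp add: matmul_distribs)
      qed
      then have "z = \<alpha> *\<^sub>R mat 1 + \<beta> *\<^sub>R J" by (simp add: algebra_simps)
      then show ?thesis by blast
    qed
    then obtain \<beta> where z_eq: "z = \<alpha> *\<^sub>R mat 1 + \<beta> *\<^sub>R J" by blast
    \<comment> \<open>Any coordinate will do: the basis vectors have square \<open>1\<close> or \<open>- 1\<close>.\<close>
    define i :: 'n where "i = undefined"
    define e :: "real^'n" where "e = axis i 1"
    have "std_form P e e \<noteq> 0" by (simp add: e_def std_form_axis)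
    moreover have "z *v e = \<alpha> *\<^sub>R e + \<beta> *\<^sub>R (J *v e)"
      by (simp add: z_eq matrix_vector_mult_add_rdistrib scaleR_matrix_vector_assoc[symmetric])
    then have "std_form P (z *v e) (z *v e) = (\<alpha>\<^sup>2 + \<beta>\<^sup>2) * std_form P e e"
      using complex_structure_form(2)[OF J, of e e] complex_structure_form(4)[OF J, of e] std_form_commute[of P "J *v e" e]
      by (simp add: form_simps power2_eq_square algebra_simps)
    moreover have "std_form P (z *v e) (z *v e) = std_form P e e"
      using z(1) GO by (auto simp: O_group_iff)
    ultimately have "\<alpha>\<^sup>2 + \<beta>\<^sup>2 = 1" by simp
    then obtain t where "\<alpha> = cos t" "\<beta> = sin t" using sincos_total_2pi by metis
    then show "z \<in> U1_group J" by (auto simp: U1_group_def z_eq)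
  qed
qed

lemma O_group_invertible:
  assumes "h \<in> O_group P"
  shows "invertible h"
proof -
  have "x = 0" if "h *v x = 0" for x
  proof (rule std_form_nondegenerate)
    fix y
    have "std_form P (h *v x) (h *v y) = std_form P x y" using assms by (simp add: O_group_iff)
    then show "std_form P x y = 0" using that by (simp add: form_simps)
  qed
  then show ?thesis
    by (auto simp: invertible_left_inverse matrix_left_invertible_ker)
qed

lemma conjugate_O_group:
  assumes h: "h \<in> O_group P" and g: "g \<in> O_group P"
  shows "h ** g ** matrix_inv h \<in> O_group P"
proof -
  note inv = matrix_inv_left_right[OF O_group_invertible[OF h]]
  have form: "std_form P (h *v x) (h *v y) = std_form P x y" "std_form P (g *v x) (g *v y) = std_form P x y" for x y
    using h g by (auto simp: O_group_iff)
  have "std_form P (matrix_inv h *v x) (matrix_inv h *v y) = std_form P x y" for x y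
    using form(1)[of "matrix_inv h *v x" "matrix_inv h *v y"] by (simp add: matrix_vector_mul_assoc inv)
  then show ?thesis
    by (simp add: O_group_iff matrix_vector_mul_assoc[symmetric] form)
qed

lemma center_conjugate:
  assumes "invertible h"
  shows "center (conjugate h G) = conjugate h (center G)"
proof -
  note inv = matrix_inv_left_right[OF assms]
  have mult: "(h ** a ** matrix_inv h) ** (h ** b ** matrix_inv h) = h ** (a ** b) ** matrix_inv h" for a b
    by (metis inv(2) matrix_mul_assoc matrix_mul_lid)
  have inj: "h ** a ** matrix_inv h = h ** b ** matrix_inv h \<longleftrightarrow> a = b" for a b
    by (metis inv(2) matrix_mul_assoc matrix_mul_lid matrix_mul_rid)
  show ?thesis
    by (auto simp: center_def conjugate_def mult inj image_iff)
qed

lemma conjugate_U1_group: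
  assumes "invertible h" and "h ** J = J' ** h"
  shows "conjugate h (U1_group J) = U1_group J'"
proof -
  note inv = matrix_inv_left_right[OF assms(1)]
  have "h ** rotation J t ** matrix_inv h = rotation J' t" for t
  proof -
    have "h ** rotation J t = rotation J' t ** h" by (simp add: rotation_def matmul_distribs assms(2))
    then show ?thesis by (metis inv(1) matrix_mul_assoc matrix_mul_rid)
  qed
  then show ?thesis by (simp add: U1_group_rotation conjugate_def image_image)
qed

text \<open>
  Irreducibility passes from \<open>G\<close> to its Lie algebra, so a nonzero abelian ideal is central there; by
  connectedness its elements commute with \<open>G\<close>.
\<close>

lemma central_lie_algebra_element:
  assumes lie: "lie_subgroup M G (O_group P)" and conn: "connected_space (mtop M)"
    and irr: "acts_irreducibly G" and nss: "\<not> semisimple_lie_algebra (lie_algebra_of M)"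
  shows "\<exists>Z \<in> lie_algebra_of M. Z \<noteq> 0 \<and> (\<forall>g \<in> G. Z ** g = g ** Z)"
proof -
  interpret immersed_lie_subgroup M G "O_group P" by unfold_locales (rule lie)
  obtain A where A: "lie_ideal A (lie_algebra_of M)" "A \<noteq> {0}"
    and abel: "\<And>a b. a \<in> A \<Longrightarrow> b \<in> A \<Longrightarrow> a ** b = b ** a"
    using nonsemisimple_abelian_ideal[OF nss] by blast
  have "0 \<in> A" using A by (simp add: lie_ideal_def subspace_0)
  with A obtain Z where Z: "Z \<in> A" "Z \<noteq> 0" by blast
  have ZL: "Z \<in> lie_algebra_of M" using A Z by (auto simp: lie_ideal_def)
  have irrL: "W = {0} \<or> W = UNIV"
    if W: "subspace W" "\<And>X w. X \<in> lie_algebra_of M \<Longrightarrow> w \<in> W \<Longrightarrow> X *v w \<in> W" for W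
  proof -
    have "\<forall>g\<in>G. \<forall>w\<in>W. g *v w \<in> W" using invariant_under_group[OF conn W] by blast
    with irr W(1) show ?thesis unfolding acts_irreducibly_def by blast
  qed
  have "X ** Z = Z ** X" if "X \<in> lie_algebra_of M" for X
    by (rule abelian_ideal_central[OF irrL A(1) abel that Z(1)])
  then have "Z ** g = g ** Z" if "g \<in> G" for g
    using commutes_with_group[OF conn _ that] by metis
  with ZL Z(2) show ?thesis by blast
qed

theorem corollary2:
  fixes p q :: nat
    and P :: "'n::finite set"
    and G :: "(real^'n^'n) set"
    and M :: "(real^'n^'n, real^'n^'n) manifold"
  assumes "card P = p" and "card (- P) = q"
    and "lie_subgroup M G (O_group P)"
    and "connected_space (mtop M)"
    and "acts_irreducibly G"
    and "\<not> semisimple_lie_algebra (lie_algebra_of M)"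
  shows "even p \<and> even q \<and>
    (\<exists>J. orthogonal_complex_structure P J) \<and>
    (\<forall>J. orthogonal_complex_structure P J \<longrightarrow>
       (\<exists>h \<in> O_group P.
          conjugate h G \<subseteq> U_group P J \<and>
          center (conjugate h G) = U1_group J))"
proof -
  interpret immersed_lie_subgroup M G "O_group P" by unfold_locales fact
  obtain Z where Z: "Z \<in> lie_algebra_of M" "Z \<noteq> 0" "\<forall>g \<in> G. Z ** g = g ** Z"
    using central_lie_algebra_element[OF assms(3-6)] by blast
  obtain \<beta> J where \<beta>: "\<beta> \<noteq> 0" "Z = \<beta> *\<^sub>R J" and J: "orthogonal_complex_structure P J"
    using skew_commutant_complex_structure[OF assms(5) Z(3)[rule_format] lie_algebra_skew[OF assms(3) Z(1)] Z(2)]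
    by blast
  have JJ: "J ** J = - mat 1" using J by (simp add: orthogonal_complex_structure_def)
  have comm: "J ** g = g ** J" if "g \<in> G" for g
    using Z(3)[rule_format, OF that] \<beta> by (simp add: matmul.scaleR_left matmul.scaleR_right)
  have "rotation J (\<beta> * t) \<in> G" for t
  proof (rule one_parameter_in_group[OF Z(1), where F = "\<lambda>t. rotation J (\<beta> * t)"])
    show "rotation J (\<beta> * (s + t)) = rotation J (\<beta> * s) ** rotation J (\<beta> * t)" for s t
      by (simp add: distrib_left rotation_add[OF JJ])
    show "rotation J (\<beta> * 0) = mat 1" by (simp add: rotation_def)
    show "((\<lambda>t. rotation J (\<beta> * t)) has_vector_derivative Z) (at 0)"
      unfolding \<beta>(2) by (rule rotation_derivative)
    show "g ** rotation J (\<beta> * t) = rotation J (\<beta> * t) ** g" if "g \<in> G" for g t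
      by (simp add: rotation_def matmul_distribs comm[OF that])
  qed
  from this[of "_ / \<beta>"] have U1: "rotation J t \<in> G" for t using \<beta>(1) by simp
  have GO: "G \<subseteq> O_group P" using G_in_H by blast
  have center: "center G = U1_group J"
    by (rule center_eq_U1_group[OF assms(5) GO J comm U1])
  have "\<exists>h \<in> O_group P. conjugate h G \<subseteq> U_group P J' \<and> center (conjugate h G) = U1_group J'"
    if J': "orthogonal_complex_structure P J'" for J'
  proof -
    obtain h where h: "h \<in> O_group P" "h ** J = J' ** h"
      using complex_structures_conjugate[OF J J'] by blast
    note inv_h = O_group_invertible[OF h(1)]
    note inv = matrix_inv_left_right[OF inv_h]
    have "conjugate h G \<subseteq> U_group P J'"
    proof
      fix x assume "x \<in> conjugate h G"
      then obtain g where g: "g \<in> G" "x = h ** g ** matrix_inv h" by (auto simp: conjugate_def)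
      have J'_eq: "J' = h ** J ** matrix_inv h"
        by (simp add: h(2) matrix_mul_assoc[symmetric] inv)
      have "x ** J' = h ** (g ** J) ** matrix_inv h" "J' ** x = h ** (J ** g) ** matrix_inv h"
        unfolding g(2) J'_eq by (metis inv(2) matrix_mul_assoc matrix_mul_lid)+
      then have "x ** J' = J' ** x" using comm[OF g(1)] by simp
      moreover have "x \<in> O_group P"
        unfolding g(2) using conjugate_O_group[OF h(1)] GO g(1) by blast
      ultimately show "x \<in> U_group P J'" by (simp add: U_group_def)
    qed
    moreover have "center (conjugate h G) = U1_group J'"
      by (simp add: center_conjugate[OF inv_h] center conjugate_U1_group[OF inv_h h(2)])
    ultimately show ?thesis using h(1) by blast
  qed
  with signature_even[OF J] J assms(1,2) show ?thesis by blast
qed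

end
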